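(* Let $X\subset\mathbb{R}^n$ be compact and assume that $F:X\times[-1,1]\to\mathcal{P}(\mathbb{R}^n)$ satisfies the Filippov conditions. For each $\lambda\in[-1,1]$, let $\Phi_\lambda:[0,\infty)\times X\to\mathcal{P}(X)$ be the multiflow defined by: $b\in\Phi_\lambda(T,a)$ if and only if there is a solution $x:[0,T]\to X$ of the differential inclusion $\dot{x}\in F(x,\lambda)$ such that $x(0)=a$ and $x(T)=b$. If $N\subset X$ is an isolating neighborhood for the multiflow $\Phi_0$, then there exists some $\varepsilon>0$ such that, for every $\lambda\in[-1,1]$, $|\lambda|<\varepsilon$ implies that $N$ is an isolating neighborhood for $\Phi_\lambda$.
   Context: $\mathcal{P}(S)$ denotes the set of all subsets of $S$; $|\cdot|$ is the Euclidean norm. For a set $S$, $B_\varepsilon(S)$ denotes the closed $\varepsilon$-neighborhood of $S$, i.e. the set of points $x$ of the ambient space with $\inf_{s\in S}|x-s|\le\varepsilon$. Filippov conditions: for a subset $Y$ of a Euclidean space, a set-valued map $F:Y\to\mathcal{P}(\mathbb{R}^n)$ satisfies the Filippov conditions if $F(y)$ is non-empty, compact and convex for each $y\in Y$, and $F$ is upper-semicontinuous: for each $y\in Y$ and each $\varepsilon>0$ there is $\delta>0$ such that $y'\in Y$, $|y-y'|<\delta$ implies $F(y')\subset B_\varepsilon(F(y))$. Here this is applied with $Y=X\times[-1,1]\subset\mathbb{R}^{n+1}$, so $F$ is upper-semicontinuous in $(x,\lambda)$ jointly. Solutions: for fixed $\lambda$ and an interval $I\subset\mathbb{R}$, a solution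 of $\dot x\in F(x,\lambda)$ in $X$ is a function $x:I\to X$, absolutely continuous (on every compact subinterval of $I$), with $\dot{x}(t)\in F(x(t),\lambda)$ for almost every $t\in I$. Solutions of $\dot x\in F(x,\lambda)$ in $X$ are called orbits on $\Phi_\lambda$. A multiflow on $X$ is an upper-semicontinuous, compact-valued (possibly empty-valued) map $\Phi:[0,\infty)\times X\to\mathcal{P}(X)$ with $\Phi(0,x)=\{x\}$ and $\Phi(t,\Phi(s,x))=\Phi(t+s,x)$, where $\Phi(t,A)=\bigcup_{x\in A}\Phi(t,x)$. For $N\subset X$, the maximal invariant set in $N$ is $\mathrm{Inv}(N,\Phi_\lambda)=\{x\in N:\ \text{there is an orbit }\psi:\mathbb{R}\to N\text{ on }\Phi_\lambda\text{ with }\psi(0)=x\}$. A compact set $N\subset X$ is an isolating neighborhood for $\Phi_\lambda$ if its maximal invariant set lies in its interior, i.e. $\mathrm{Inv}(N,\Phi_\lambda)\cap\partial N=\emptyset$, where $\partial N$ is the topological boundary of $N$ in $\mathbb{R}^n$. *)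

theory Defs
  imports "HOL-Analysis.Analysis"
begin

(* Infimum distance to the empty set is infinite in the mathematical convention, whereas
   infdist x {} = 0; hence the neighbourhood of the empty set has to be made empty by hand. *)
definition closed_nbhd :: "real \<Rightarrow> 'a::metric_space set \<Rightarrow> 'a set" where
  "closed_nbhd \<epsilon> S = {x. S \<noteq> {} \<and> infdist x S \<le> \<epsilon>}"

definition upper_semicontinuous_on ::
    "'b::metric_space set \<Rightarrow> ('b \<Rightarrow> 'a::metric_space set) \<Rightarrow> bool" where
  "upper_semicontinuous_on Y F \<longleftrightarrow>
     (\<forall>y\<in>Y. \<forall>\<epsilon>>0. \<exists>\<delta>>0. \<forall>y'\<in>Y. dist y y' < \<delta> \<longrightarrow> F y' \<subseteq> closed_nbhd \<epsilon> (F y))"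

definition filippov ::
    "'b::euclidean_space set \<Rightarrow> ('b \<Rightarrow> (real^'n) set) \<Rightarrow> bool" where
  "filippov Y F \<longleftrightarrow>
     (\<forall>y\<in>Y. F y \<noteq> {} \<and> compact (F y) \<and> convex (F y)) \<and> upper_semicontinuous_on Y F"

(* The classical epsilon-delta definition on [a,b]; the intervals [u i, v i], i < n,
   are required to be non-overlapping. *)
definition abs_continuous_between ::
    "real \<Rightarrow> real \<Rightarrow> (real \<Rightarrow> 'a::real_normed_vector) \<Rightarrow> bool" where
  "abs_continuous_between a b f \<longleftrightarrow>
     (\<forall>\<epsilon>>0. \<exists>\<delta>>0. \<forall>(n::nat) u v.
        (\<forall>i<n. a \<le> u i \<and> u i \<le> v i \<and> v i \<le> b) \<and>
        (\<forall>i<n. \<forall>j<n. i \<noteq> j \<longrightarrow> {u i<..<v i} \<inter> {u j<..<v j} = {}) \<and>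
        (\<Sum>i<n. v i - u i) < \<delta>
        \<longrightarrow> (\<Sum>i<n. norm (f (v i) - f (u i))) < \<epsilon>)"

(* x is a total function of which only the restriction to I matters; accordingly the
   derivative is taken within I, which is the ordinary one at interior points of I. *)
definition inclusion_solution ::
    "((real^'n) \<times> real \<Rightarrow> (real^'n) set) \<Rightarrow> (real^'n) set \<Rightarrow> real \<Rightarrow> real set \<Rightarrow>
     (real \<Rightarrow> real^'n) \<Rightarrow> bool" where
  "inclusion_solution F X l I x \<longleftrightarrow>
     is_interval I \<and> (\<forall>t\<in>I. x t \<in> X) \<and>
     (\<forall>a b. a \<le> b \<and> {a..b} \<subseteq> I \<longrightarrow> abs_continuous_between a b x) \<and>
     (AE t in lebesgue. t \<in> I \<longrightarrow>
        (\<exists>v\<in>F (x t, l). (x has_vector_derivative v) (at t within I)))"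

definition inclusion_flow ::
    "((real^'n) \<times> real \<Rightarrow> (real^'n) set) \<Rightarrow> (real^'n) set \<Rightarrow> real \<Rightarrow>
     real \<Rightarrow> real^'n \<Rightarrow> (real^'n) set" where
  "inclusion_flow F X l T a =
     {b. \<exists>x. inclusion_solution F X l {0..T} x \<and> x 0 = a \<and> x T = b}"

(* A multiflow on X is a map on [0,\<infinity>) \<times> X; values at other arguments are irrelevant. *)
definition multiflow ::
    "'a::metric_space set \<Rightarrow> (real \<Rightarrow> 'a \<Rightarrow> 'a set) \<Rightarrow> bool" where
  "multiflow X \<Phi> \<longleftrightarrow>
     (\<forall>t\<ge>0. \<forall>x\<in>X. \<Phi> t x \<subseteq> X \<and> compact (\<Phi> t x)) \<and>
     upper_semicontinuous_on ({0..} \<times> X) (\<lambda>(t, x). \<Phi> t x) \<and>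
     (\<forall>x\<in>X. \<Phi> 0 x = {x}) \<and>
     (\<forall>t\<ge>0. \<forall>s\<ge>0. \<forall>x\<in>X. (\<Union>y\<in>\<Phi> s x. \<Phi> t y) = \<Phi> (t + s) x)"

(* Orbits on the multiflow inclusion_flow F X l are by definition the solutions of the
   differential inclusion, so the following notions take F, X and l as parameters. *)
definition maximal_invariant_set ::
    "((real^'n) \<times> real \<Rightarrow> (real^'n) set) \<Rightarrow> (real^'n) set \<Rightarrow> real \<Rightarrow>
     (real^'n) set \<Rightarrow> (real^'n) set" where
  "maximal_invariant_set F X l N =
     {x\<in>N. \<exists>\<psi>. inclusion_solution F X l UNIV \<psi> \<and> (\<forall>t. \<psi> t \<in> N) \<and> \<psi> 0 = x}"

definition isolating_neighborhood ::
    "((real^'n) \<times> real \<Rightarrow> (real^'n) set) \<Rightarrow> (real^'n) set \<Rightarrow> real \<Rightarrow>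
     (real^'n) set \<Rightarrow> bool" where
  "isolating_neighborhood F X l N \<longleftrightarrow>
     compact N \<and> N \<subseteq> X \<and> maximal_invariant_set F X l N \<inter> frontier N = {}"

end

(*
  Along a solution, the mean value theorem for absolutely continuous curves puts every chord slope
  (x b - x a) / (b - a) into each closed convex set containing all velocity sets along [a, b].
  Conversely a curve with this property is Lipschitz, hence differentiable almost everywhere, and
  upper semicontinuity puts its derivatives into the velocity sets. The chord formulation contains
  no derivatives, so it survives restriction, translation, concatenation and pointwise limits, also
  when the parameter varies. By compactness, limits of solutions thus exist and are solutions. This
  gives the multiflow axioms; and if the claim on isolating neighborhoods failed, full orbits in N
  through frontier points for parameters tending to 0 would accumulate at such an orbit for the
  parameter 0.
*)
theory Submission
  imports Defs "HOL-Complex_Analysis.Great_Picard"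
begin

section \<open>Increments of absolutely continuous functions\<close>

text \<open>The familiar route to limits of solutions extracts weakly convergent derivatives; chords
  replace it by pointwise limits of difference quotients in fixed closed convex sets. Here convexity
  of the values enters: an average velocity need not be a velocity, but it lies in every closed
  convex set that contains the velocities. The price is paid in real analysis, for scalar functions
  only. A solution is at first merely absolutely continuous in the epsilon-delta sense, so the
  passage to chords needs an increment estimate for such functions; a hyperplane separating a point
  from a convex set reduces it to the scalar case. The way back needs almost everywhere
  differentiability of Lipschitz curves only, because velocities are bounded over the compact set of
  states and parameters; coordinates reduce this to real functions, where a Vitali covering argument
  applies. Upper semicontinuity controls velocities only near a limit point; a common Lipschitz
  constant keeps nearby curves there for a short time independent of the sequence index.\<close>

lemma abs_continuous_between_finite:
  fixes f :: "real \<Rightarrow> 'a::real_normed_vector"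
  assumes "abs_continuous_between a b f" "\<epsilon> > 0"
  shows "\<exists>\<delta>>0. \<forall>(P :: 'i set) u v. finite P \<longrightarrow> (\<forall>i\<in>P. a \<le> u i \<and> u i \<le> v i \<and> v i \<le> b) \<longrightarrow>
        disjoint_family_on (\<lambda>i. {u i<..<v i}) P \<longrightarrow> (\<Sum>i\<in>P. v i - u i) < \<delta> \<longrightarrow>
        (\<Sum>i\<in>P. norm (f (v i) - f (u i))) < \<epsilon>"
proof -
  have "\<exists>\<delta>>0. \<forall>(n::nat) u v.
      (\<forall>i<n. a \<le> u i \<and> u i \<le> v i \<and> v i \<le> b) \<and>
      (\<forall>i<n. \<forall>j<n. i \<noteq> j \<longrightarrow> {u i<..<v i} \<inter> {u j<..<v j} = {}) \<and>
      (\<Sum>i<n. v i - u i) < \<delta> \<longrightarrow> (\<Sum>i<n. norm (f (v i) - f (u i))) < \<epsilon>"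
    using assms(1) [unfolded abs_continuous_between_def, THEN spec, of \<epsilon>] assms(2) by (rule mp)
  then obtain \<delta> where "\<delta> > 0" and \<delta>: "\<forall>(n::nat) u v.
      (\<forall>i<n. a \<le> u i \<and> u i \<le> v i \<and> v i \<le> b) \<and>
      (\<forall>i<n. \<forall>j<n. i \<noteq> j \<longrightarrow> {u i<..<v i} \<inter> {u j<..<v j} = {}) \<and>
      (\<Sum>i<n. v i - u i) < \<delta> \<longrightarrow> (\<Sum>i<n. norm (f (v i) - f (u i))) < \<epsilon>"
    by (elim exE conjE)
  show ?thesis
  proof (rule exI [of _ \<delta>], intro conjI allI impI \<open>\<delta> > 0\<close>)
    fix P :: "'i set" and u v
    assume P: "finite P" and uv: "\<forall>i\<in>P. a \<le> u i \<and> u i \<le> v i \<and> v i \<le> b"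
      and disj: "disjoint_family_on (\<lambda>i. {u i<..<v i}) P" and sum: "(\<Sum>i\<in>P. v i - u i) < \<delta>"
    obtain h where h: "bij_betw h {..<card P} P"
      using ex_bij_betw_nat_finite [OF P] by (auto simp: atLeast0LessThan)
    have reindex: "(\<Sum>i<card P. \<phi> (h i)) = (\<Sum>i\<in>P. \<phi> i)" for \<phi> :: "'i \<Rightarrow> real"
      by (rule sum.reindex_bij_betw [OF h])
    have hP: "h i \<in> P" if "i < card P" for i
      using h that bij_betwE by fastforce
    have "(\<Sum>i<card P. norm (f (v (h i)) - f (u (h i)))) < \<epsilon>"
    proof (rule \<delta> [THEN spec, THEN spec, THEN spec, THEN mp], intro conjI)
      show "\<forall>i<card P. \<forall>j<card P. i \<noteq> j \<longrightarrow> {u (h i)<..<v (h i)} \<inter> {u (h j)<..<v (h j)} = {}"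
      proof (intro allI impI)
        fix i j assume "i < card P" "j < card P" "i \<noteq> j"
        then have "h i \<noteq> h j"
          using h by (auto simp: bij_betw_def inj_on_def)
        then show "{u (h i)<..<v (h i)} \<inter> {u (h j)<..<v (h j)} = {}"
          using disj hP \<open>i < card P\<close> \<open>j < card P\<close> unfolding disjoint_family_on_def by blast
      qed
      show "(\<Sum>i<card P. v (h i) - u (h i)) < \<delta>"
        using reindex [of "\<lambda>i. v i - u i"] sum by simp
    qed (use uv hP in auto)
    then show "(\<Sum>i\<in>P. norm (f (v i) - f (u i))) < \<epsilon>"
      using reindex [of "\<lambda>i. norm (f (v i) - f (u i))"] by simp
  qed
qed

lemma emeasure_lebesgue_outer_open:
  fixes B :: "'a::euclidean_space set"
  assumes "B \<in> sets lebesgue" "e > 0"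
  shows "\<exists>U. open U \<and> B \<subseteq> U \<and> emeasure lebesgue U \<le> emeasure lebesgue B + ennreal e"
proof -
  obtain U where U: "open U" "B \<subseteq> U" "(U - B) \<in> lmeasurable" "emeasure lebesgue (U - B) < ennreal e"
    by (rule sets_lebesgue_outer_open [OF assms])
  have "emeasure lebesgue (B \<union> (U - B)) \<le> emeasure lebesgue B + emeasure lebesgue (U - B)"
    by (rule emeasure_subadditive [OF assms(1) fmeasurableD [OF U(3)]])
  also have "\<dots> \<le> emeasure lebesgue B + ennreal e"
    by (rule add_left_mono [OF less_imp_le [OF U(4)]])
  also have "B \<union> (U - B) = U"
    using U(2) by blast
  finally show ?thesis
    using U by blast
qed

text \<open>Sum over a fine tagged division. Intervals tagged in the exceptional null set lie in an
  open set of small measure, and absolute continuity makes their contribution small.\<close>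
lemma abs_continuous_increment_le:
  fixes g :: "real \<Rightarrow> real"
  assumes "a \<le> b" and ac: "abs_continuous_between a b g"
    and deriv: "AE t in lebesgue. t \<in> {a..b} \<longrightarrow>
        (\<exists>d\<le>c. (g has_vector_derivative d) (at t within {a..b}))"
  shows "g b - g a \<le> c * (b - a)"
proof -
  define E where "E = {t \<in> {a..b}. \<not> (\<exists>d\<le>c. (g has_vector_derivative d) (at t within {a..b}))}"
  have E0: "E \<in> null_sets lebesgue"
  proof -
    obtain Z where "Z \<in> null_sets lebesgue" "E \<subseteq> Z"
      using deriv unfolding E_def by (auto simp: eventually_ae_filter)
    then show ?thesis
      by (metis completion.complete2)
  qed
  \<comment> \<open>The \<open>2\<close> counts two errors of the badly tagged intervals: the
    increment of \<open>g\<close> over them, and \<open>c\<close> times their total length, which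
    the main term includes.\<close>
  have approx: "g b - g a \<le> c * (b - a) + \<epsilon> * (b - a + 2)" if "\<epsilon> > 0" for \<epsilon>
  proof -
    \<comment> \<open>The pairs of a tagged division serve directly as indices, which is why any
      finite index set was allowed above.\<close>
    obtain \<delta>0 where "\<delta>0 > 0" and \<delta>0: "\<forall>(P :: (real \<times> real set) set) u v. finite P \<longrightarrow>
        (\<forall>i\<in>P. a \<le> u i \<and> u i \<le> v i \<and> v i \<le> b) \<longrightarrow>
        disjoint_family_on (\<lambda>i. {u i<..<v i}) P \<longrightarrow> (\<Sum>i\<in>P. v i - u i) < \<delta>0 \<longrightarrow>
        (\<Sum>i\<in>P. norm (g (v i) - g (u i))) < \<epsilon>"
      using abs_continuous_between_finite [OF ac \<open>\<epsilon> > 0\<close>] by (elim exE conjE)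
    \<comment> \<open>The second bound makes \<open>\<bar>c\<bar>\<close> times the total length of
      the badly tagged intervals at most \<open>\<epsilon>\<close>; adding \<open>1\<close> covers
      \<open>c = 0\<close>.\<close>
    define \<delta> where "\<delta> = min \<delta>0 (\<epsilon> / (\<bar>c\<bar> + 1))"
    have "\<delta> > 0"
      using \<open>\<delta>0 > 0\<close> \<open>\<epsilon> > 0\<close> by (simp add: \<delta>_def)
    obtain U where U: "open U" "E \<subseteq> U" and "emeasure lebesgue U \<le> emeasure lebesgue E + ennreal (\<delta> / 2)"
      using emeasure_lebesgue_outer_open [OF null_setsD2 [OF E0], of "\<delta> / 2"] \<open>\<delta> > 0\<close> by auto
    moreover have "ennreal (\<delta> / 2) < ennreal \<delta>"
      using \<open>\<delta> > 0\<close> by (intro ennreal_lessI) auto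
    ultimately have emU: "emeasure lebesgue U < ennreal \<delta>"
      using E0 by (simp add: null_setsD1)
    have "\<exists>r>0. \<forall>s\<in>{a..b}. \<bar>s - t\<bar> < r \<longrightarrow> \<bar>g s - g t - d * (s - t)\<bar> \<le> \<epsilon> * \<bar>s - t\<bar>"
      if "(g has_vector_derivative d) (at t within {a..b})" for t d
      using that \<open>\<epsilon> > 0\<close>
      unfolding has_vector_derivative_def has_derivative_within_alt
      by (simp add: mult.commute)
    then have "\<exists>r d. r > 0 \<and> (t \<in> {a..b} - E \<longrightarrow> d \<le> c \<and> 
        (\<forall>s\<in>{a..b}. \<bar>s - t\<bar> < r \<longrightarrow> \<bar>g s - g t - d * (s - t)\<bar> \<le> \<epsilon> * \<bar>s - t\<bar>))" for t
      unfolding E_def by (cases "t \<in> {a..b} - E") (force simp: E_def intro: zero_less_one)+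
    then obtain r d where r0: "\<And>t. r t > 0" and
      rd: "\<And>t. t \<in> {a..b} - E \<Longrightarrow> d t \<le> c \<and> 
        (\<forall>s\<in>{a..b}. \<bar>s - t\<bar> < r t \<longrightarrow> \<bar>g s - g t - d t * (s - t)\<bar> \<le> \<epsilon> * \<bar>s - t\<bar>)"
      by metis
    define \<gamma> where "\<gamma> t = (if t \<in> E then U else ball t (r t))" for t
    have "gauge \<gamma>"
      using U r0 by (auto simp: gauge_def \<gamma>_def)
    then obtain p where p: "p tagged_division_of {a..b}" and fine: "\<gamma> fine p"
      using fine_division_exists_real by blast
    have fin: "finite p"
      using p by blast
    have K: "\<exists>u v. K = {u..v} \<and> u \<le> t \<and> t \<le> v \<and> a \<le> u \<and> v \<le> b \<and> {u..v} \<subseteq> \<gamma> t"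
      if tK: "(t, K) \<in> p" for t K
    proof -
      obtain u v where "K = {u..v}"
        using tagged_division_ofD(4) [OF p tK] by (auto simp: box_real)
      moreover have "t \<in> K" "K \<subseteq> {a..b}" "K \<subseteq> \<gamma> t"
        using tagged_division_ofD(2,3) [OF p tK] tK fine unfolding fine_def by blast+
      ultimately show ?thesis by auto
    qed
    \<comment> \<open>Endpoints as infimum and supremum match the form in which increments over a
      tagged division telescope.\<close>
    define u v :: "real \<times> real set \<Rightarrow> real" where "u i = Inf (snd i)" and "v i = Sup (snd i)" for i
    have uv: "snd i = {u i..v i} \<and> u i \<le> fst i \<and> fst i \<le> v i \<and> a \<le> u i \<and> v i \<le> b \<and>
        {u i..v i} \<subseteq> \<gamma> (fst i)" if "i \<in> p" for i
      using K [of "fst i" "snd i"] that by (force simp: u_def v_def)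
    have disj: "disjoint_family_on (\<lambda>i. {u i<..<v i}) p"
      unfolding disjoint_family_on_def
    proof (intro ballI impI)
      fix i j assume ij: "i \<in> p" "j \<in> p" "i \<noteq> j"
      then have "interior (snd i) \<inter> interior (snd j) = {}"
        using tagged_division_ofD(5) [OF p, of "fst i" "snd i" "fst j" "snd j"] by auto
      then show "{u i<..<v i} \<inter> {u j<..<v j} = {}"
        using uv ij by (metis interior_atLeastAtMost_real)
    qed
    define B where "B = {i \<in> p. fst i \<in> E}"
    have "B \<subseteq> p" by (auto simp: B_def)
    have disjB: "disjoint_family_on (\<lambda>i. {u i<..<v i}) B"
      using disj \<open>B \<subseteq> p\<close> by (rule disjoint_family_on_mono [rotated])
    have lenB: "(\<Sum>i\<in>B. v i - u i) < \<delta>"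
    proof -
      have "ennreal (\<Sum>i\<in>B. v i - u i) = (\<Sum>i\<in>B. emeasure lebesgue {u i<..<v i})"
        using uv \<open>B \<subseteq> p\<close> by (subst sum_ennreal [symmetric]) (force intro!: sum.cong)+
      also have "\<dots> = emeasure lebesgue (\<Union>i\<in>B. {u i<..<v i})"
        using disjB fin \<open>B \<subseteq> p\<close> by (intro sum_emeasure) (auto intro: finite_subset)
      also have "\<dots> \<le> emeasure lebesgue U"
      proof (rule emeasure_mono)
        show "(\<Union>i\<in>B. {u i<..<v i}) \<subseteq> U"
          using uv by (fastforce simp: B_def \<gamma>_def subset_iff)
      qed (use U in auto)
      also have "\<dots> < ennreal \<delta>" by (rule emU)
      finally show "(\<Sum>i\<in>B. v i - u i) < \<delta>"
        by (metis ennreal_leI leI leD)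
    qed
    have "(\<Sum>i\<in>B. norm (g (v i) - g (u i))) < \<epsilon>"
    proof (rule \<delta>0 [rule_format, OF _ _ disjB])
      show "(\<Sum>i\<in>B. v i - u i) < \<delta>0"
        using lenB by (simp add: \<delta>_def)
      show "finite B"
        using \<open>B \<subseteq> p\<close> fin finite_subset by blast
    qed (use uv \<open>B \<subseteq> p\<close> in force)
    then have bad: "(\<Sum>i\<in>B. g (v i) - g (u i)) \<le> \<epsilon>"
      by (smt (verit) sum_mono real_norm_def)
    have good: "g (v i) - g (u i) \<le> (c + \<epsilon>) * (v i - u i)" if "i \<in> p - B" for i
    proof -
      define t where "t = fst i"
      have t: "t \<in> {a..b} - E" "u i \<le> t" "t \<le> v i" "u i \<in> {a..b}" "v i \<in> {a..b}"
        using uv [of i] that by (auto simp: B_def t_def)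
      have "{u i..v i} \<subseteq> ball t (r t)" "u i \<in> {u i..v i}" "v i \<in> {u i..v i}"
        using uv [of i] that t by (auto simp: \<gamma>_def t_def simp del: mem_ball)
      then have "u i \<in> ball t (r t)" "v i \<in> ball t (r t)"
        by blast+
      then have "\<bar>v i - t\<bar> < r t" "\<bar>u i - t\<bar> < r t"
        by (auto simp: dist_real_def)
      then have "\<bar>g (v i) - g t - d t * (v i - t)\<bar> \<le> \<epsilon> * \<bar>v i - t\<bar>"
        "\<bar>g (u i) - g t - d t * (u i - t)\<bar> \<le> \<epsilon> * \<bar>u i - t\<bar>"
        using rd [OF t(1)] t(4,5) by blast+
      \<comment> \<open>The tag \<open>t\<close> lies between the endpoints, so the errors
        \<open>\<epsilon> * (v i - t)\<close> and \<open>\<epsilon> * (t - u i)\<close> add up to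
        \<open>\<epsilon> * (v i - u i)\<close>.\<close>
      then have "g (v i) - g (u i) \<le> (d t + \<epsilon>) * (v i - u i)"
        using t by (simp add: algebra_simps)
      also have "\<dots> \<le> (c + \<epsilon>) * (v i - u i)"
        using rd [OF t(1)] t by (intro mult_right_mono) auto
      finally show ?thesis .
    qed
    have len: "(\<Sum>i\<in>p. v i - u i) = b - a"
      using additive_tagged_division_1 [OF \<open>a \<le> b\<close> p, of "\<lambda>x. x"]
      by (simp add: u_def v_def case_prod_beta)
    have lenB0: "0 \<le> (\<Sum>i\<in>B. v i - u i)"
      using uv \<open>B \<subseteq> p\<close> by (force intro: sum_nonneg)
    have split: "sum \<phi> p = sum \<phi> (p - B) + sum \<phi> B" for \<phi> :: "_ \<Rightarrow> real"
      by (rule sum.subset_diff [OF \<open>B \<subseteq> p\<close> fin])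
    have "\<bar>c\<bar> * (\<Sum>i\<in>B. v i - u i) \<le> \<bar>c\<bar> * (\<epsilon> / (\<bar>c\<bar> + 1))"
      using lenB by (intro mult_left_mono) (auto simp: \<delta>_def)
    also have "\<dots> \<le> \<epsilon>"
      using \<open>\<epsilon> > 0\<close> by (simp add: field_simps)
    finally have cB: "- (c * (\<Sum>i\<in>B. v i - u i)) \<le> \<epsilon>"
      using lenB0 by (smt (verit) mult_minus_left mult_right_mono)
    have "g b - g a = (\<Sum>i\<in>p. g (v i) - g (u i))"
      using additive_tagged_division_1 [OF \<open>a \<le> b\<close> p, of g]
      by (simp add: u_def v_def case_prod_beta)
    also have "\<dots> \<le> (\<Sum>i\<in>p - B. (c + \<epsilon>) * (v i - u i)) + \<epsilon>"
      unfolding split using bad good by (intro add_mono sum_mono) auto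
    also have "\<dots> = (c + \<epsilon>) * (b - a - (\<Sum>i\<in>B. v i - u i)) + \<epsilon>"
      using split [of "\<lambda>i. v i - u i"] len by (simp flip: sum_distrib_left)
    also have "\<dots> \<le> c * (b - a) + \<epsilon> * (b - a + 2)"
      using cB mult_nonneg_nonneg [OF less_imp_le [OF \<open>\<epsilon> > 0\<close>] lenB0]
      by (simp add: algebra_simps)
    finally show ?thesis .
  qed
  show ?thesis
  proof (rule field_le_epsilon)
    fix e :: real assume "e > 0"
    then show "g b - g a \<le> c * (b - a) + e"
      using approx [of "e / (b - a + 2)"] \<open>a \<le> b\<close> by simp
  qed
qed

section \<open>Lipschitz functions are differentiable almost everywhere\<close>

lemma outer_measure_image_le:
  fixes f :: "real \<Rightarrow> real"
  assumes f: "strict_mono f" "continuous_on UNIV f" and "0 \<le> p"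
    and slope: "\<And>x d. \<lbrakk>x \<in> S; d > 0\<rbrakk> \<Longrightarrow>
        \<exists>u v. u \<le> x \<and> x \<le> v \<and> u < v \<and> v - u < d \<and> f v - f u \<le> p * (v - u)"
  shows "outer_measure_of lebesgue (f ` S) \<le> ennreal p * outer_measure_of lebesgue S"
proof -
  obtain B where B: "S \<subseteq> B" "B \<in> sets lebesgue" "outer_measure_of lebesgue S = emeasure lebesgue B"
    using outer_measure_of_attain [of S lebesgue] by auto
  have "outer_measure_of lebesgue (f ` S) \<le> ennreal p * (emeasure lebesgue B + ennreal e)" if "e > 0" for e
  proof -
    obtain U where U: "open U" "B \<subseteq> U" and emU: "emeasure lebesgue U \<le> emeasure lebesgue B + ennreal e"
      using emeasure_lebesgue_outer_open [OF B(2) \<open>e > 0\<close>] by blast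
    define K where "K = {(u, v). u < v \<and> {u..v} \<subseteq> U \<and> f v - f u \<le> p * (v - u)}"
    \<comment> \<open>The covering theorem speaks of balls: midpoint and half length of the image
      interval.\<close>
    define c r where "c i = (f (fst i) + f (snd i)) / 2" and "r i = (f (snd i) - f (fst i)) / 2" for i
    have "c i - r i = f (fst i)" "c i + r i = f (snd i)" for i
      by (simp_all add: c_def r_def field_simps)
    then have cball: "cball (c i) (r i) = {f (fst i)..f (snd i)}" for i
      by (simp add: cball_eq_atLeastAtMost)
    have "r i > 0" if "i \<in> K" for i
      using that f(1) by (auto simp: K_def r_def strict_mono_def)
    moreover have "\<exists>i. i \<in> K \<and> y \<in> cball (c i) (r i) \<and> r i < d" if y: "y \<in> f ` S" and "0 < d" for y d
    proof -
      obtain x where x: "x \<in> S" "y = f x"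
        using y by blast
      have "isCont f x"
        using f(2) by (simp add: continuous_on_eq_continuous_at)
      then obtain \<rho> where \<rho>: "\<rho> > 0" "\<And>z. \<bar>z - x\<bar> < \<rho> \<Longrightarrow> \<bar>f z - f x\<bar> < d"
        using \<open>0 < d\<close> unfolding continuous_at_eps_delta dist_real_def by blast
      have "x \<in> U"
        using x U B by blast
      then obtain \<sigma> where \<sigma>: "\<sigma> > 0" "ball x \<sigma> \<subseteq> U"
        using U(1) open_contains_ball by blast
      \<comment> \<open>Length below \<open>\<sigma>\<close> keeps the interval inside
        \<open>U\<close>; length below \<open>\<rho>\<close> makes the radius of its image less than
        \<open>d\<close>.\<close>
      obtain u v where uv: "u \<le> x" "x \<le> v" "u < v" "v - u < min \<rho> \<sigma>" "f v - f u \<le> p * (v - u)"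
        using slope [OF x(1), of "min \<rho> \<sigma>"] \<rho> \<sigma> by auto
      have "{u..v} \<subseteq> ball x \<sigma>"
        using uv by (auto simp: dist_real_def)
      moreover have "\<bar>f u - f x\<bar> < d" "\<bar>f v - f x\<bar> < d"
        using \<rho>(2) uv by auto
      moreover have "f u \<le> f x" "f x \<le> f v"
        using uv f(1) by (auto simp: strict_mono_less_eq)
      ultimately show ?thesis
        using uv \<sigma> x by (intro exI [of _ "(u, v)"]) (unfold cball, auto simp: K_def r_def)
    qed
    ultimately obtain C where C: "countable C" "C \<subseteq> K"
        "pairwise (\<lambda>i j. disjnt (cball (c i) (r i)) (cball (c j) (r j))) C"
        "negligible (f ` S - (\<Union>i\<in>C. cball (c i) (r i)))"
      by (rule Vitali_covering_theorem_cballs [of K r "f ` S" c])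
    let ?W = "\<Union>i\<in>C. {f (fst i)..f (snd i)}"
    let ?N = "f ` S - ?W"
    have N: "?N \<in> null_sets lebesgue"
      using C(4) by (simp add: cball negligible_iff_null_sets)
    have W: "?W \<in> sets lebesgue"
      using C(1) by (intro sets.countable_UN') auto
    have disj: "disjoint_family_on (\<lambda>i. {f (fst i)..f (snd i)}) C"
      using C(3) unfolding cball pairwise_def disjnt_def disjoint_family_on_def by blast
    have disj': "disjoint_family_on (\<lambda>i. {fst i..snd i}) C"
      unfolding disjoint_family_on_def
    proof (intro ballI impI)
      fix i j assume "i \<in> C" "j \<in> C" "i \<noteq> j"
      then have "{f (fst i)..f (snd i)} \<inter> {f (fst j)..f (snd j)} = {}"
        using disj by (simp add: disjoint_family_on_def)
      moreover have "f x \<in> {f (fst i)..f (snd i)} \<inter> {f (fst j)..f (snd j)}"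
        if "x \<in> {fst i..snd i} \<inter> {fst j..snd j}" for x
        using that f(1) by (auto simp: strict_mono_less_eq)
      ultimately show "{fst i..snd i} \<inter> {fst j..snd j} = {}"
        by blast
    qed
    have "outer_measure_of lebesgue (f ` S) \<le> outer_measure_of lebesgue (?N \<union> ?W)"
      by (intro outer_measure_of_mono) auto
    also have "\<dots> = emeasure lebesgue (?N \<union> ?W)"
      by (intro outer_measure_of_eq sets.Un null_setsD2 [OF N] W)
    also have "\<dots> = emeasure lebesgue ?W"
      using N W by (subst Un_commute) (intro emeasure_Un_null_set, auto)
    also have "\<dots> = (\<integral>\<^sup>+ i. emeasure lebesgue {f (fst i)..f (snd i)} \<partial>count_space C)"
      using C(1) disj by (intro emeasure_UN_countable) auto
    also have "\<dots> \<le> (\<integral>\<^sup>+ i. ennreal p * emeasure lebesgue {fst i..snd i} \<partial>count_space C)"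
    proof (rule nn_integral_mono)
      fix i assume "i \<in> space (count_space C)"
      then have i: "fst i < snd i" "f (snd i) - f (fst i) \<le> p * (snd i - fst i)" "f (fst i) \<le> f (snd i)"
        using C(2) f(1) by (auto simp: K_def strict_mono_less_eq)
      then show "emeasure lebesgue {f (fst i)..f (snd i)} \<le> ennreal p * emeasure lebesgue {fst i..snd i}"
        using \<open>0 \<le> p\<close> by (simp add: ennreal_leI flip: ennreal_mult)
    qed
    also have "\<dots> = ennreal p * (\<integral>\<^sup>+ i. emeasure lebesgue {fst i..snd i} \<partial>count_space C)"
      by (rule nn_integral_cmult) auto
    also have "\<dots> = ennreal p * emeasure lebesgue (\<Union>i\<in>C. {fst i..snd i})"
      using C(1) disj' by (subst emeasure_UN_countable) auto
    also have "\<dots> \<le> ennreal p * emeasure lebesgue U"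
      using C(2) U(1) by (intro mult_left_mono emeasure_mono) (auto simp: K_def subset_iff)
    also have "\<dots> \<le> ennreal p * (emeasure lebesgue B + ennreal e)"
      by (intro mult_left_mono emU) auto
    finally show ?thesis .
  qed
  then have le: "outer_measure_of lebesgue (f ` S) \<le> ennreal p * emeasure lebesgue B + ennreal (p * e)"
    if "e > 0" for e
    using that \<open>0 \<le> p\<close> by (simp add: distrib_left ennreal_mult)
  have "outer_measure_of lebesgue (f ` S) \<le> ennreal p * emeasure lebesgue B"
  proof (rule ennreal_le_epsilon)
    fix e :: real assume "e > 0"
    have "p * (e / (p + 1)) \<le> e"
      using \<open>e > 0\<close> \<open>0 \<le> p\<close> by (simp add: field_simps)
    then show "outer_measure_of lebesgue (f ` S) \<le> ennreal p * emeasure lebesgue B + ennreal e"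
      using le [of "e / (p + 1)"] \<open>e > 0\<close> \<open>0 \<le> p\<close>
      by (meson add_left_mono divide_pos_pos ennreal_leI order_trans add_nonneg_pos zero_less_one)
  qed
  then show ?thesis
    by (simp add: B)
qed

text \<open>A set on which small slopes below \<open>p\<close> and above \<open>q\<close> both occur is mapped by \<open>f\<close> with
  expansion at most \<open>p\<close>, and by the inverse of \<open>f\<close> with expansion at most \<open>1 / q\<close>.\<close>
lemma oscillating_slopes_negligible:
  fixes f :: "real \<Rightarrow> real"
  assumes f: "strict_mono f" "continuous_on UNIV f" "surj f" 
    and lower: "\<And>x y. x \<le> y \<Longrightarrow> y - x \<le> f y - f x"
    and "bounded S" "0 < p" "p < q"
    and small: "\<And>x d. \<lbrakk>x \<in> S; d > 0\<rbrakk> \<Longrightarrow>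
        \<exists>u v. u \<le> x \<and> x \<le> v \<and> u < v \<and> v - u < d \<and> f v - f u \<le> p * (v - u)"
    and large: "\<And>x d. \<lbrakk>x \<in> S; d > 0\<rbrakk> \<Longrightarrow>
        \<exists>u v. u \<le> x \<and> x \<le> v \<and> u < v \<and> v - u < d \<and> q * (v - u) \<le> f v - f u"
  shows "negligible S"
proof -
  define h where "h = inv f"
  have hf: "h (f x) = x" and fh: "f (h y) = y" for x y
    using f by (auto simp: h_def surj_f_inv_f strict_mono_imp_inj_on)
  have h: "strict_mono h"
    using f(1) fh by (metis strict_mono_def strict_mono_less)
  have h_lip: "h y - h x \<le> y - x" "0 \<le> h y - h x" if "x \<le> y" for x y
  proof -
    show *: "0 \<le> h y - h x"
      using h that by (simp add: strict_mono_less_eq)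
    show "h y - h x \<le> y - x"
      using lower [of "h x" "h y"] * by (simp add: fh)
  qed
  \<comment> \<open>The growth bound \<open>lower\<close> makes the inverse 1-Lipschitz, so the
    image estimate applies to it as well.\<close>
  have cont_h: "continuous_on UNIV h"
  proof -
    have "\<bar>h y - h x\<bar> \<le> \<bar>y - x\<bar>" for x y
      using h_lip [of x y] h_lip [of y x] by linarith
    then have "1-lipschitz_on UNIV h"
      by (intro lipschitz_onI) (auto simp: dist_real_def)
    then show ?thesis
      by (rule lipschitz_on_continuous_on)
  qed
  have "0 < q"
    using assms by simp
  let ?\<mu> = "outer_measure_of lebesgue"
  have "?\<mu> S = ?\<mu> (h ` (f ` S))"
    by (simp add: image_image hf)
  also have "\<dots> \<le> ennreal (1 / q) * ?\<mu> (f ` S)"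
  proof (rule outer_measure_image_le [OF h cont_h])
    fix y d :: real assume y: "y \<in> f ` S" and "d > 0"
    then obtain x where x: "x \<in> S" "y = f x" by blast
    have "isCont f x"
      using f(2) by (simp add: continuous_on_eq_continuous_at)
    then obtain \<rho> where \<rho>: "\<rho> > 0" "\<And>z. \<bar>z - x\<bar> < \<rho> \<Longrightarrow> \<bar>f z - f x\<bar> < d / 2"
      using \<open>0 < d\<close> unfolding continuous_at_eps_delta dist_real_def by (meson half_gt_zero)
    obtain u v where uv: "u \<le> x" "x \<le> v" "u < v" "v - u < \<rho>" "q * (v - u) \<le> f v - f u"
      using large [OF x(1) \<rho>(1)] by auto
    have "\<bar>f u - f x\<bar> < d / 2" "\<bar>f v - f x\<bar> < d / 2"
      using \<rho>(2) uv by auto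
    moreover have "f u \<le> f x" "f x \<le> f v" "f u < f v"
      using uv f(1) by (auto simp: strict_mono_less_eq strict_mono_less)
    ultimately have "f u \<le> y \<and> y \<le> f v \<and> f u < f v \<and> f v - f u < d \<and>
        h (f v) - h (f u) \<le> 1 / q * (f v - f u)"
      using uv \<open>0 < q\<close> x by (auto simp: hf field_simps)
    then show "\<exists>u v. u \<le> y \<and> y \<le> v \<and> u < v \<and> v - u < d \<and> h v - h u \<le> 1 / q * (v - u)"
      by blast
  qed (use \<open>0 < q\<close> in simp)
  also have "\<dots> \<le> ennreal (1 / q) * (ennreal p * ?\<mu> S)"
    by (intro mult_left_mono outer_measure_image_le f small) (use \<open>0 < p\<close> in auto)
  also have "\<dots> = ennreal (p / q) * ?\<mu> S"
    using \<open>0 < q\<close> \<open>0 < p\<close> by (simp add: mult.assoc [symmetric] flip: ennreal_mult)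
  finally have le: "?\<mu> S \<le> ennreal (p / q) * ?\<mu> S" .
  \<comment> \<open>Boundedness makes the outer measure of \<open>S\<close> finite, so an estimate
    by itself with the factor \<open>p / q < 1\<close> forces it to vanish.\<close>
  obtain B where B: "S \<subseteq> B" "B \<in> sets lebesgue" "?\<mu> S = emeasure lebesgue B"
    using outer_measure_of_attain [of S lebesgue] by auto
  obtain R where "S \<subseteq> cball 0 R"
    using \<open>bounded S\<close> by (force simp: bounded_iff)
  then have "?\<mu> S \<le> ?\<mu> (cball (0::real) R)"
    using outer_measure_of_mono [of S "cball 0 R" lebesgue] by simp
  also have "\<dots> = emeasure lebesgue (cball (0::real) R)"
    by (intro outer_measure_of_eq) auto
  also have "\<dots> < \<infinity>"
    using emeasure_lborel_cball_finite [of "0::real" R] by simp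
  finally obtain m where m: "?\<mu> S = ennreal m" "m \<ge> 0"
    by (metis ennreal_cases infinity_ennreal_def less_irrefl)
  then have "m \<le> p / q * m"
    using le \<open>0 < p\<close> \<open>0 < q\<close> by (simp flip: ennreal_mult)
  then have "m * q \<le> m * p"
    using \<open>0 < q\<close> by (simp add: field_simps)
  then have "m = 0"
    using \<open>p < q\<close> m(2) by (simp add: mult_le_cancel_left)
  then have "B \<in> null_sets lebesgue"
    using B m by auto
  then show ?thesis
    using B(1) by (metis negligible_iff_null_sets negligible_subset)
qed

text \<open>A difference quotient is symmetric in its two points, so \<open>x\<close> may be the
  left or the right end of the interval, according to the side on which the second point
  falls.\<close>

lemma frequently_slope_interval:
  fixes f :: "real \<Rightarrow> real"
  assumes "frequently (\<lambda>y. P ((f y - f x) / (y - x))) (at x)" "d > 0"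
  obtains u v where "u \<le> x" "x \<le> v" "u < v" "v - u < d" "P ((f v - f u) / (v - u))"
proof -
  obtain y where y: "P ((f y - f x) / (y - x))" "y \<noteq> x" "\<bar>y - x\<bar> < d"
    using assms unfolding frequently_def eventually_at dist_real_def by blast
  show thesis
  proof (cases "x < y")
    case True
    then show ?thesis
      using y that [of x y] by auto
  next
    case False
    have "(f y - f x) / (y - x) = (f x - f y) / (x - y)"
      by (metis minus_diff_eq minus_divide_divide)
    then show ?thesis
      using y that [of y x] False by auto
  qed
qed

text \<open>Where no derivative exists, the lower and upper limits of the slopes differ, and two
  rationals fit strictly between them. This leaves countably many sets on which slopes oscillate
  across a fixed gap.\<close>

lemma bilipschitz_increasing_nondifferentiable_negligible:
  fixes f :: "real \<Rightarrow> real"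
  assumes lower: "\<And>x y. x \<le> y \<Longrightarrow> y - x \<le> f y - f x"
    and upper: "\<And>x y. x \<le> y \<Longrightarrow> f y - f x \<le> L * (y - x)"
  shows "negligible {x. \<not> f differentiable at x}"
proof -
  have mono: "strict_mono f"
    using lower by (smt (verit) strict_monoI)
  have "L-lipschitz_on UNIV f"
  proof (rule lipschitz_onI)
    show "0 \<le> L"
      using lower [of 0 1] upper [of 0 1] by simp
    show "dist (f x) (f y) \<le> L * dist x y" for x y
      using lower [of x y] upper [of x y] lower [of y x] upper [of y x]
      by (cases "x \<le> y") (auto simp: dist_real_def)
  qed
  then have cont: "continuous_on UNIV f"
    by (rule lipschitz_on_continuous_on)
  have surj: "surj f"
  proof (rule surjI)
    fix y
    have "\<exists>x. f x = y"
    \<comment> \<open>Growing at least as fast as the identity, \<open>f\<close> attains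
      \<open>y\<close> within distance \<open>\<bar>y - f 0\<bar>\<close> of
      \<open>0\<close>.\<close>
    proof (rule IVT' [of f "- \<bar>y - f 0\<bar>" y "\<bar>y - f 0\<bar>", THEN exE])
      show "f (- \<bar>y - f 0\<bar>) \<le> y"
        using lower [of "- \<bar>y - f 0\<bar>" 0] by auto
      show "y \<le> f \<bar>y - f 0\<bar>"
        using lower [of 0 "\<bar>y - f 0\<bar>"] by auto
    qed (use cont continuous_on_subset in auto)
    then show "f (SOME x. f x = y) = y"
      by (rule someI_ex)
  qed
  define slope where "slope x y = (f y - f x) / (y - x)" for x y
  \<comment> \<open>Intersecting with balls supplies the boundedness that the oscillation lemma asks
    for.\<close>
  define S where "S p q n = {x \<in> cball 0 (real n). frequently (\<lambda>y. slope x y \<le> p) (at x) \<and>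
      frequently (\<lambda>y. q \<le> slope x y) (at x)}" for p q and n :: nat
  have slope1: "1 \<le> slope x y" "slope x y \<le> L" if "x \<noteq> y" for x y
    using that lower [of x y] upper [of x y] lower [of y x] upper [of y x]
    by (cases "x < y"; simp add: slope_def field_simps)+
  \<comment> \<open>All slopes are at least \<open>1\<close>, so the set is empty for
    \<open>p < 1\<close>; otherwise \<open>p\<close> is positive, as the oscillation lemma
    requires.\<close>
  have S: "negligible (S p q n)" if "p < q" for p q n
  proof (cases "1 \<le> p")
    case False
    have "S p q n = {}"
    proof -
      have "eventually (\<lambda>y. \<not> slope x y \<le> p) (at x)" for x
        using slope1(1) [of x] False by (force simp: eventually_at_filter intro: always_eventually)
      then show ?thesis
        by (auto simp: S_def frequently_def)
    qed
    then show ?thesis by simp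
  next
    case True
    show ?thesis
    proof (rule oscillating_slopes_negligible [OF mono cont surj lower, of _ p q])
      show "bounded (S p q n)"
        by (rule bounded_subset [of "cball 0 (real n)"]) (auto simp: S_def)
      fix x d :: real assume x: "x \<in> S p q n" and "d > 0"
      obtain u v where "u \<le> x" "x \<le> v" "u < v" "v - u < d" "(f v - f u) / (v - u) \<le> p"
        using frequently_slope_interval [of "\<lambda>s. s \<le> p" f x d] x \<open>d > 0\<close> unfolding S_def slope_def by blast
      moreover from this have "f v - f u \<le> p * (v - u)"
        by (simp add: field_simps)
      ultimately show "\<exists>u v. u \<le> x \<and> x \<le> v \<and> u < v \<and> v - u < d \<and> f v - f u \<le> p * (v - u)"
        by blast
      obtain u v where "u \<le> x" "x \<le> v" "u < v" "v - u < d" "q \<le> (f v - f u) / (v - u)"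
        using frequently_slope_interval [of "\<lambda>s. q \<le> s" f x d] x \<open>d > 0\<close> unfolding S_def slope_def by blast
      moreover from this have "q * (v - u) \<le> f v - f u"
        by (simp add: field_simps)
      ultimately show "\<exists>u v. u \<le> x \<and> x \<le> v \<and> u < v \<and> v - u < d \<and> q * (v - u) \<le> f v - f u"
        by blast
    qed (use True that in auto)
  qed
  have "{x. \<not> f differentiable at x} \<subseteq> (\<Union>(p, q)\<in>{(p, q). p \<in> \<rat> \<and> q \<in> \<rat> \<and> p < q}. \<Union>n. S p q n)"
  proof
    fix x assume "x \<in> {x. \<not> f differentiable at x}"
    then have nd: "\<not> (slope x \<longlongrightarrow> D) (at x)" for D
      unfolding slope_def real_differentiable_def has_field_derivative_iff by (auto simp: differentiable_def dest: has_field_derivative_imp_has_derivative)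
    let ?s = "\<lambda>y. ereal (slope x y)"
    have bot: "at x \<noteq> bot" by simp
    have ev: "eventually (\<lambda>y. 1 \<le> slope x y \<and> slope x y \<le> L) (at x)"
      using slope1 [of x] by (force simp: eventually_at_filter intro: always_eventually)
    \<comment> \<open>Equality would give the slopes a limit in the extended reals; the bounds
      \<open>1\<close> and \<open>L\<close> make it finite, hence a derivative.\<close>
    have "Liminf (at x) ?s \<noteq> Limsup (at x) ?s"
    proof
      assume "Liminf (at x) ?s = Limsup (at x) ?s"
      then have lim: "(?s \<longlongrightarrow> Limsup (at x) ?s) (at x)"
        by (rule Liminf_eq_Limsup [OF bot _ refl])
      have "ereal 1 \<le> Limsup (at x) ?s"
        using ev by (intro tendsto_lowerbound [OF lim _ bot]) (auto elim: eventually_mono)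
      moreover have "Limsup (at x) ?s \<le> ereal L"
        using ev by (intro tendsto_upperbound [OF lim _ bot]) (auto elim: eventually_mono)
      ultimately obtain D where "Limsup (at x) ?s = ereal D"
        by (cases "Limsup (at x) ?s") auto
      then show False
        using lim nd by simp
    qed
    then have "Liminf (at x) ?s < Limsup (at x) ?s"
      using Liminf_le_Limsup [OF bot, of ?s] by simp
    then obtain p' where p': "Liminf (at x) ?s < ereal (real_of_rat p')" "ereal (real_of_rat p') < Limsup (at x) ?s"
      using ereal_dense3 by blast
    then obtain q' where q': "ereal (real_of_rat p') < ereal (real_of_rat q')" "ereal (real_of_rat q') < Limsup (at x) ?s"
      using ereal_dense3 by blast
    define p q where "p = real_of_rat p'" and "q = real_of_rat q'"
    have pq: "p \<in> \<rat>" "q \<in> \<rat>" "p < q" "Liminf (at x) ?s < ereal p" "ereal q < Limsup (at x) ?s"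
      using p' q' by (auto simp: p_def q_def)
    have "frequently (\<lambda>y. slope x y \<le> p) (at x)"
    proof (rule ccontr)
      assume "\<not> ?thesis"
      then have "ereal p \<le> Liminf (at x) ?s"
        by (intro Liminf_bounded) (auto simp: not_frequently elim: eventually_mono)
      then show False using pq by simp
    qed
    moreover have "frequently (\<lambda>y. q \<le> slope x y) (at x)"
    proof (rule ccontr)
      assume "\<not> ?thesis"
      then have "Limsup (at x) ?s \<le> ereal q"
        by (intro Limsup_bounded) (auto simp: not_frequently elim: eventually_mono)
      then show False using pq by simp
    qed
    moreover obtain n :: nat where "norm x \<le> real n"
      using real_arch_simple by blast
    ultimately have "x \<in> S p q n"
      by (simp add: S_def)
    then show "x \<in> (\<Union>(p, q)\<in>{(p, q). p \<in> \<rat> \<and> q \<in> \<rat> \<and> p < q}. \<Union>n. S p q n)"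
      using pq by blast
  qed
  moreover have "negligible (\<Union>(p, q)\<in>{(p, q). p \<in> \<rat> \<and> q \<in> \<rat> \<and> p < q}. \<Union>n. S p q n)"
  proof -
    have "countable {(p :: real, q). p \<in> \<rat> \<and> q \<in> \<rat> \<and> p < q}"
      by (rule countable_subset [of _ "\<rat> \<times> \<rat>"]) (auto intro: countable_rat)
    then show ?thesis
      using S by (intro negligible_countable_Union countable_image) (auto intro!: negligible_countable_Union)
  qed
  ultimately show ?thesis
    by (rule negligible_subset [rotated])
qed

text \<open>Adding \<open>(L + 1) x\<close> makes a real \<open>L\<close>-Lipschitz function increasing and bi-Lipschitz.\<close>
lemma lipschitz_real_nondifferentiable_negligible:
  fixes f :: "real \<Rightarrow> real"
  assumes "L-lipschitz_on UNIV f"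
  shows "negligible {x. \<not> f differentiable at x}"
proof -
  define g where "g x = f x + (L + 1) * x" for x
  have *: "\<bar>f y - f x\<bar> \<le> L * (y - x)" if "x \<le> y" for x y
    using lipschitz_onD [OF assms, of y x] that by (simp add: dist_real_def)
  have "negligible {x. \<not> g differentiable at x}"
  proof (rule bilipschitz_increasing_nondifferentiable_negligible)
    fix x y :: real assume "x \<le> y"
    then show "y - x \<le> g y - g x" "g y - g x \<le> (2 * L + 1) * (y - x)"
      using * [of x y] by (auto simp: g_def algebra_simps)
  qed
  moreover have "f differentiable at x" if "g differentiable at x" for x
  proof -
    have "(\<lambda>x. g x - (L + 1) * x) differentiable at x"
      using that by (intro derivative_intros)
    then show ?thesis
      by (simp add: g_def)
  qed
  ultimately show ?thesis
    by (elim negligible_subset) auto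
qed

lemma lipschitz_vector_nondifferentiable_negligible:
  fixes f :: "real \<Rightarrow> 'a::euclidean_space"
  assumes "L-lipschitz_on UNIV f"
  shows "negligible {x. \<not> f differentiable at x}"
proof -
  have "negligible {x. \<not> (\<lambda>x. f x \<bullet> i) differentiable at x}" if "i \<in> Basis" for i
  proof (rule lipschitz_real_nondifferentiable_negligible)
    show "L-lipschitz_on UNIV (\<lambda>x. f x \<bullet> i)"
    proof (rule lipschitz_onI)
      fix x y
      have "dist (f x \<bullet> i) (f y \<bullet> i) \<le> dist (f x) (f y)"
        using that Basis_le_norm [of i "f x - f y"] by (simp add: dist_norm inner_diff_left)
      also have "\<dots> \<le> L * dist x y"
        using lipschitz_onD [OF assms] by simp
      finally show "dist (f x \<bullet> i) (f y \<bullet> i) \<le> L * dist x y" .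
    qed (rule lipschitz_on_nonneg [OF assms])
  qed
  then have "negligible (\<Union>i\<in>Basis. {x. \<not> (\<lambda>x. f x \<bullet> i) differentiable at x})"
    by (intro negligible_Union) auto
  then show ?thesis
    by (rule negligible_subset) (auto simp: differentiable_componentwise_within [of f])
qed

section \<open>Velocity sets\<close>

text \<open>Compactness makes the distance attained. Convexity and boundedness of the neighbourhood
  are then inherited from the summands of this Minkowski sum.\<close>

lemma closed_nbhd_eq_plus_cball:
  fixes S :: "'a::euclidean_space set"
  assumes "compact S"
  shows "closed_nbhd \<epsilon> S = (\<Union>x\<in>S. \<Union>y\<in>cball 0 \<epsilon>. {x + y})"
proof (intro equalityI subsetI)
  fix z assume "z \<in> closed_nbhd \<epsilon> S"
  then have "S \<noteq> {}" "infdist z S \<le> \<epsilon>"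
    by (auto simp: closed_nbhd_def)
  then obtain x where "x \<in> S" "dist z x \<le> \<epsilon>"
    using infdist_attains_inf [of S z] assms compact_imp_closed by metis
  then have "z - x \<in> cball 0 \<epsilon>" "z = x + (z - x)"
    by (simp_all add: dist_norm norm_minus_commute)
  then show "z \<in> (\<Union>x\<in>S. \<Union>y\<in>cball 0 \<epsilon>. {x + y})"
    using \<open>x \<in> S\<close> by blast
next
  fix z assume "z \<in> (\<Union>x\<in>S. \<Union>y\<in>cball 0 \<epsilon>. {x + y})"
  then obtain x y where "x \<in> S" "norm y \<le> \<epsilon>" "z = x + y"
    by auto
  then show "z \<in> closed_nbhd \<epsilon> S"
    using infdist_le [of x S z] by (auto simp: closed_nbhd_def dist_norm norm_minus_commute)
qed

lemma convex_closed_nbhd: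
  fixes S :: "'a::euclidean_space set"
  assumes "compact S" "convex S"
  shows "convex (closed_nbhd \<epsilon> S)"
  unfolding closed_nbhd_eq_plus_cball [OF assms(1)]
  by (intro convex_sums assms convex_cball)

lemma closed_closed_nbhd: "closed (closed_nbhd \<epsilon> S)"
proof (cases "S = {}")
  case False
  have "closed {x. infdist x S \<le> \<epsilon>}"
    by (intro closed_Collect_le continuous_intros)
  then show ?thesis
    using False by (simp add: closed_nbhd_def)
qed (simp add: closed_nbhd_def)

lemma bounded_closed_nbhd:
  fixes S :: "'a::euclidean_space set"
  assumes "compact S"
  shows "bounded (closed_nbhd \<epsilon> S)"
  unfolding closed_nbhd_eq_plus_cball [OF assms]
  by (intro bounded_sums compact_imp_bounded assms bounded_cball)

lemma in_all_closed_nbhds: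
  assumes "closed S" "\<And>\<epsilon>. \<epsilon> > 0 \<Longrightarrow> v \<in> closed_nbhd \<epsilon> S"
  shows "v \<in> S"
proof -
  have "S \<noteq> {}"
    using assms(2) [of 1] by (auto simp: closed_nbhd_def)
  moreover have "infdist v S \<le> 0"
    by (rule field_le_epsilon) (use assms(2) in \<open>auto simp: closed_nbhd_def\<close>)
  ultimately show ?thesis
    using assms(1) in_closed_iff_infdist_zero infdist_nonneg by (metis order_antisym)
qed

text \<open>Upper semicontinuity with tolerance \<open>1\<close> bounds the values near each point,
  and finitely many such balls cover \<open>Y\<close>. The bound becomes the common Lipschitz
  constant of all solutions for all parameters.\<close>

lemma filippov_bounded:
  assumes "compact Y" "filippov Y F"
  obtains M where "M > 0" "\<And>y. y \<in> Y \<Longrightarrow> F y \<subseteq> cball 0 M"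
proof -
  have "bounded (\<Union>y\<in>Y. F y)"
  proof -
    have "\<exists>\<delta>>0. \<forall>y'\<in>Y. dist y y' < \<delta> \<longrightarrow> F y' \<subseteq> closed_nbhd 1 (F y)" if "y \<in> Y" for y
      using assms(2) that unfolding filippov_def upper_semicontinuous_on_def by force
    then obtain \<delta> where \<delta>: "\<And>y. y \<in> Y \<Longrightarrow> \<delta> y > 0"
      "\<And>y y'. \<lbrakk>y \<in> Y; y' \<in> Y; dist y y' < \<delta> y\<rbrakk> \<Longrightarrow> F y' \<subseteq> closed_nbhd 1 (F y)"
      by metis
    have "Y \<subseteq> (\<Union>y\<in>Y. ball y (\<delta> y))"
      using \<delta>(1) by force
    then obtain D where D: "D \<subseteq> Y" "finite D" "Y \<subseteq> (\<Union>y\<in>D. ball y (\<delta> y))"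
      using compactE_image [OF assms(1), of Y "\<lambda>y. ball y (\<delta> y)"] by blast
    have "(\<Union>y\<in>Y. F y) \<subseteq> (\<Union>y\<in>D. closed_nbhd 1 (F y))"
    proof (intro UN_least)
      fix y' assume "y' \<in> Y"
      then obtain y where "y \<in> D" "dist y y' < \<delta> y"
        using D(3) by auto
      then show "F y' \<subseteq> (\<Union>y\<in>D. closed_nbhd 1 (F y))"
        using \<delta>(2) [of y y'] D(1) \<open>y' \<in> Y\<close> by blast
    qed
    moreover have "bounded (\<Union>y\<in>D. closed_nbhd 1 (F y))"
      using D assms(2) by (intro bounded_UN ballI bounded_closed_nbhd) (auto simp: filippov_def)
    ultimately show ?thesis
      by (rule bounded_subset [rotated])
  qed
  then obtain M where "M > 0" "\<And>v. v \<in> (\<Union>y\<in>Y. F y) \<Longrightarrow> norm v \<le> M"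
    unfolding bounded_pos by blast
  then show thesis
    by (intro that [of M]) (auto simp: subset_iff)
qed

section \<open>Solutions in terms of chords\<close>

text \<open>Letting \<open>C\<close> vary expresses membership in the closed convex hull of the
  velocity sets along the interval without forming that hull. Later arguments choose a convenient
  \<open>C\<close>: a ball, or a closed neighbourhood of one velocity set.\<close>

definition chord_solution ::
    "((real^'n) \<times> real \<Rightarrow> (real^'n) set) \<Rightarrow> real \<Rightarrow> real set \<Rightarrow> (real \<Rightarrow> real^'n) \<Rightarrow> bool" where
  "chord_solution F l I x \<longleftrightarrow>
     (\<forall>a\<in>I. \<forall>b\<in>I. \<forall>C. a < b \<and> closed C \<and> convex C \<and> (\<forall>t\<in>{a..b}. F (x t, l) \<subseteq> C) \<longrightarrow>
        (x b - x a) /\<^sub>R (b - a) \<in> C)"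

lemma chord_solutionD:
  assumes "chord_solution F l I x" "a \<in> I" "b \<in> I" "a < b" "closed C" "convex C"
    "\<And>t. \<lbrakk>a \<le> t; t \<le> b\<rbrakk> \<Longrightarrow> F (x t, l) \<subseteq> C"
  shows "(x b - x a) /\<^sub>R (b - a) \<in> C"
  using assms unfolding chord_solution_def by simp

section \<open>Absolute continuity of scalar components and of Lipschitz curves\<close>

lemma abs_continuous_between_inner:
  fixes x :: "real \<Rightarrow> 'a::real_inner"
  assumes "abs_continuous_between a b x"
  shows "abs_continuous_between a b (\<lambda>t. w \<bullet> x t)"
  unfolding abs_continuous_between_def
proof (intro allI impI)
  fix \<epsilon> :: real assume "\<epsilon> > 0"
  then have "\<epsilon> / (norm w + 1) > 0"
    by (simp add: add_nonneg_pos)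
  with assms obtain \<delta> where "\<delta> > 0" and \<delta>: "\<forall>(n::nat) u v.
        (\<forall>i<n. a \<le> u i \<and> u i \<le> v i \<and> v i \<le> b) \<and>
        (\<forall>i<n. \<forall>j<n. i \<noteq> j \<longrightarrow> {u i<..<v i} \<inter> {u j<..<v j} = {}) \<and>
        (\<Sum>i<n. v i - u i) < \<delta>
        \<longrightarrow> (\<Sum>i<n. norm (x (v i) - x (u i))) < \<epsilon> / (norm w + 1)"
    unfolding abs_continuous_between_def by (elim allE [of _ "\<epsilon> / (norm w + 1)"] impE exE conjE)
  have "(\<Sum>i<n. norm (w \<bullet> x (v i) - w \<bullet> x (u i))) < \<epsilon>"
    if "(\<Sum>i<n. norm (x (v i) - x (u i))) < \<epsilon> / (norm w + 1)" for n :: nat and u v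
  proof -
    have "(\<Sum>i<n. norm (w \<bullet> x (v i) - w \<bullet> x (u i))) \<le> (\<Sum>i<n. (norm w + 1) * norm (x (v i) - x (u i)))"
    proof (rule sum_mono)
      fix i
      have "norm (w \<bullet> x (v i) - w \<bullet> x (u i)) \<le> norm w * norm (x (v i) - x (u i))"
        using Cauchy_Schwarz_ineq2 [of w "x (v i) - x (u i)"] by (simp add: inner_diff_right)
      then show "norm (w \<bullet> x (v i) - w \<bullet> x (u i)) \<le> (norm w + 1) * norm (x (v i) - x (u i))"
        by (simp add: distrib_right add_increasing2)
    qed
    also have "\<dots> < \<epsilon>"
      using that by (simp add: sum_distrib_left [symmetric] pos_less_divide_eq add_nonneg_pos mult.commute)
    finally show ?thesis .
  qed
  with \<open>\<delta> > 0\<close> \<delta> show "\<exists>\<delta>>0. \<forall>(n::nat) u v.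
        (\<forall>i<n. a \<le> u i \<and> u i \<le> v i \<and> v i \<le> b) \<and>
        (\<forall>i<n. \<forall>j<n. i \<noteq> j \<longrightarrow> {u i<..<v i} \<inter> {u j<..<v j} = {}) \<and>
        (\<Sum>i<n. v i - u i) < \<delta>
        \<longrightarrow> (\<Sum>i<n. norm (w \<bullet> x (v i) - w \<bullet> x (u i))) < \<epsilon>"
    by (intro exI [of _ \<delta>]) simp
qed

lemma lipschitz_abs_continuous_between:
  assumes "M-lipschitz_on {a..b} x"
  shows "abs_continuous_between a b x"
  unfolding abs_continuous_between_def
proof (intro allI impI)
  fix \<epsilon> :: real assume "\<epsilon> > 0"
  have "0 \<le> M"
    by (rule lipschitz_on_nonneg [OF assms])
  have "(\<Sum>i<n. norm (x (v i) - x (u i))) < \<epsilon>"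
    if "\<forall>i<n. a \<le> u i \<and> u i \<le> v i \<and> v i \<le> b" "(\<Sum>i<n. v i - u i) < \<epsilon> / (M + 1)" for n :: nat and u v
  proof -
    have "(\<Sum>i<n. norm (x (v i) - x (u i))) \<le> (\<Sum>i<n. (M + 1) * (v i - u i))"
    proof (rule sum_mono)
      fix i assume "i \<in> {..<n}"
      then have i: "a \<le> u i" "u i \<le> v i" "v i \<le> b"
        using that(1) by auto
      have "norm (x (v i) - x (u i)) \<le> M * (v i - u i)"
        using lipschitz_onD [OF assms, of "v i" "u i"] i by (auto simp: dist_norm)
      then show "norm (x (v i) - x (u i)) \<le> (M + 1) * (v i - u i)"
        using i by (simp add: distrib_right)
    qed
    also have "\<dots> < \<epsilon>"
      using that(2) \<open>0 \<le> M\<close> by (simp add: sum_distrib_left [symmetric] pos_less_divide_eq mult.commute)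
    finally show ?thesis .
  qed
  moreover have "\<epsilon> / (M + 1) > 0"
    using \<open>0 \<le> M\<close> \<open>\<epsilon> > 0\<close> by simp
  ultimately show "\<exists>\<delta>>0. \<forall>(n::nat) u v.
        (\<forall>i<n. a \<le> u i \<and> u i \<le> v i \<and> v i \<le> b) \<and>
        (\<forall>i<n. \<forall>j<n. i \<noteq> j \<longrightarrow> {u i<..<v i} \<inter> {u j<..<v j} = {}) \<and>
        (\<Sum>i<n. v i - u i) < \<delta>
        \<longrightarrow> (\<Sum>i<n. norm (x (v i) - x (u i))) < \<epsilon>"
    by (intro exI [of _ "\<epsilon> / (M + 1)"]) simp
qed

text \<open>A chord slope outside \<open>C\<close> is strictly separated from \<open>C\<close> by a
  hyperplane with normal \<open>w\<close>. The scalar function \<open>w \<bullet> x\<close> has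
  derivative above \<open>c\<close> almost everywhere, which contradicts its increment.\<close>

lemma inclusion_solution_imp_chord_solution:
  assumes sol: "inclusion_solution F X l I x"
  shows "chord_solution F l I x"
  unfolding chord_solution_def
proof (intro ballI allI impI; elim conjE; rule ccontr)
  fix a b C
  assume ab: "a \<in> I" "b \<in> I" "a < b" and C: "closed C" "convex C"
    and FC: "\<forall>t\<in>{a..b}. F (x t, l) \<subseteq> C" and z: "(x b - x a) /\<^sub>R (b - a) \<notin> C"
  obtain w c where w: "w \<bullet> ((x b - x a) /\<^sub>R (b - a)) < c" "\<And>v. v \<in> C \<Longrightarrow> c < w \<bullet> v"
    using separating_hyperplane_closed_point [OF C(2,1) z] by auto
  have sub: "{a..b} \<subseteq> I"
    using sol ab unfolding inclusion_solution_def is_interval_1 by (meson atLeastAtMost_iff subsetI)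
  \<comment> \<open>The signs are reversed because the increment estimate bounds from above.\<close>
  have "((- w) \<bullet> x b) - ((- w) \<bullet> x a) \<le> (- c) * (b - a)"
  proof (rule abs_continuous_increment_le [of a b "\<lambda>t. (- w) \<bullet> x t"])
    show "abs_continuous_between a b (\<lambda>t. (- w) \<bullet> x t)"
      using sol sub ab by (intro abs_continuous_between_inner) (simp add: inclusion_solution_def)
    have "AE t in lebesgue. t \<in> I \<longrightarrow> (\<exists>v\<in>F (x t, l). (x has_vector_derivative v) (at t within I))"
      using sol by (simp add: inclusion_solution_def)
    then show "AE t in lebesgue. t \<in> {a..b} \<longrightarrow>
        (\<exists>d\<le>- c. ((\<lambda>t. (- w) \<bullet> x t) has_vector_derivative d) (at t within {a..b}))"
    proof (rule AE_mp, intro AE_I2 impI)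
      fix t
      assume "t \<in> I \<longrightarrow> (\<exists>v\<in>F (x t, l). (x has_vector_derivative v) (at t within I))" "t \<in> {a..b}"
      then obtain v where v: "v \<in> F (x t, l)" "(x has_vector_derivative v) (at t within I)"
        using sub by blast
      have "c < w \<bullet> v"
        using w(2) FC v \<open>t \<in> {a..b}\<close> by blast
      moreover have "((\<lambda>t. (- w) \<bullet> x t) has_vector_derivative (- w) \<bullet> v) (at t within {a..b})"
        using v(2) sub by (intro bounded_linear.has_vector_derivative [OF bounded_linear_inner_right])
          (rule has_vector_derivative_within_subset)
      ultimately show "\<exists>d\<le>- c. ((\<lambda>t. (- w) \<bullet> x t) has_vector_derivative d) (at t within {a..b})"
        by (intro exI [of _ "(- w) \<bullet> v"]) auto
    qed
  qed (use ab in simp)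
  then have "c * (b - a) \<le> w \<bullet> (x b - x a)"
    by (simp add: inner_diff_right algebra_simps)
  moreover have "w \<bullet> (x b - x a) < c * (b - a)"
    using w(1) ab by (simp add: divide_inverse_commute [symmetric] pos_divide_less_eq del: inner_diff_right)
  ultimately show False by simp
qed

text \<open>A Lipschitz curve whose difference quotients at \<open>t\<close> eventually enter every neighbourhood of
  the velocity set at \<open>t\<close> has its derivative there, wherever it exists.\<close>
lemma inclusion_solution_if_local_chords:
  assumes lip: "M-lipschitz_on UNIV x" and I: "is_interval I" and X: "\<And>t. t \<in> I \<Longrightarrow> x t \<in> X"
    and cl: "\<And>t. t \<in> I \<Longrightarrow> closed (F (x t, l))"
    and chords: "\<And>t \<epsilon>. \<lbrakk>t \<in> interior I; \<epsilon> > 0\<rbrakk> \<Longrightarrow>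
        \<forall>\<^sub>F s in at t. (x s - x t) /\<^sub>R (s - t) \<in> closed_nbhd \<epsilon> (F (x t, l))"
  shows "inclusion_solution F X l I x"
  unfolding inclusion_solution_def
proof (intro conjI allI impI ballI I X)
  fix a b :: real
  show "abs_continuous_between a b x"
    by (rule lipschitz_abs_continuous_between) (rule lipschitz_on_subset [OF lip], simp)
next
  \<comment> \<open>Chords are controlled at interior points only; the frontier of an interval is a
    null set and may be discarded too.\<close>
  have "negligible ({t. \<not> x differentiable at t} \<union> frontier I)"
    using lipschitz_vector_nondifferentiable_negligible [OF lip] I
    by (intro negligible_Un negligible_convex_frontier is_interval_convex)
  then have "AE t in lebesgue. t \<notin> {t. \<not> x differentiable at t} \<union> frontier I"
    by (intro AE_not_in) (simp add: negligible_iff_null_sets)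
  then show "AE t in lebesgue. t \<in> I \<longrightarrow> (\<exists>v\<in>F (x t, l). (x has_vector_derivative v) (at t within I))"
  proof (rule AE_mp, intro AE_I2 impI)
    fix t assume t: "t \<notin> {t. \<not> x differentiable at t} \<union> frontier I" "t \<in> I"
    then have int: "t \<in> interior I"
      using closure_subset by (auto simp: frontier_def)
    obtain v where v: "(x has_vector_derivative v) (at t)"
      using t(1) vector_derivative_works by blast
    have lim: "((\<lambda>s. (x s - x t) /\<^sub>R (s - t)) \<longlongrightarrow> v) (at t)"
    proof -
      have "((\<lambda>s. norm (x s - x t - (s - t) *\<^sub>R v) / norm (s - t)) \<longlongrightarrow> 0) (at t)"
        using v unfolding has_vector_derivative_def has_derivative_iff_norm by simp
      moreover have "norm (x s - x t - (s - t) *\<^sub>R v) / norm (s - t) = norm ((x s - x t) /\<^sub>R (s - t) - v)"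
        if "s \<noteq> t" for s
      proof -
        have "(x s - x t) /\<^sub>R (s - t) - v = (x s - x t - (s - t) *\<^sub>R v) /\<^sub>R (s - t)"
          using that by (simp add: scaleR_diff_right)
        then show ?thesis
          by (simp add: divide_inverse mult.commute)
      qed
      ultimately have "((\<lambda>s. norm ((x s - x t) /\<^sub>R (s - t) - v)) \<longlongrightarrow> 0) (at t)"
        by (elim Lim_transform_eventually) (auto simp: eventually_at_filter)
      then show ?thesis
        by (simp add: tendsto_norm_zero_iff LIM_zero_iff)
    qed
    have "v \<in> F (x t, l)"
    proof (rule in_all_closed_nbhds [OF cl [OF t(2)]])
      fix \<epsilon> :: real assume "\<epsilon> > 0"
      then show "v \<in> closed_nbhd \<epsilon> (F (x t, l))"
        by (intro Lim_in_closed_set [OF closed_closed_nbhd chords [OF int] _ lim]) auto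
    qed
    then show "\<exists>v\<in>F (x t, l). (x has_vector_derivative v) (at t within I)"
      using v has_vector_derivative_at_within by blast
  qed
qed

lemma chord_solution_lipschitz:
  assumes "chord_solution F l I x" "M \<ge> 0" "\<And>t. t \<in> I \<Longrightarrow> F (x t, l) \<subseteq> cball 0 M" "is_interval I"
  shows "M-lipschitz_on I x"
proof -
  have *: "dist (x a) (x b) \<le> M * dist a b" if "a \<in> I" "b \<in> I" "a < b" for a b
  proof -
    have "(x b - x a) /\<^sub>R (b - a) \<in> cball 0 M"
    proof (rule chord_solutionD [OF assms(1) that])
      fix t assume "a \<le> t" "t \<le> b"
      then have "t \<in> I"
        using assms(4) that unfolding is_interval_1 by blast
      then show "F (x t, l) \<subseteq> cball 0 M"
        by (rule assms(3))
    qed auto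
    then have "norm (x b - x a) \<le> M * (b - a)"
      using that by (simp add: divide_inverse_commute [symmetric] pos_divide_le_eq)
    then show ?thesis
      using that by (simp add: dist_norm norm_minus_commute)
  qed
  show ?thesis
  proof (rule lipschitz_onI [OF _ \<open>M \<ge> 0\<close>])
    fix a b assume "a \<in> I" "b \<in> I"
    then show "dist (x a) (x b) \<le> M * dist a b"
      using * [of a b] * [of b a] by (cases a b rule: linorder_cases) (auto simp: dist_commute)
  qed
qed

section \<open>Chord solutions under restriction, translation and concatenation\<close>

lemma chord_solution_cong:
  assumes "chord_solution F l I x" "is_interval I" "\<And>t. t \<in> I \<Longrightarrow> y t = x t"
  shows "chord_solution F l I y"
  unfolding chord_solution_def
proof (intro ballI allI impI; elim conjE)
  fix a b C
  assume ab: "a \<in> I" "b \<in> I" "a < b" and C: "closed C" "convex C" "\<forall>t\<in>{a..b}. F (y t, l) \<subseteq> C"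
  have "(x b - x a) /\<^sub>R (b - a) \<in> C"
  proof (rule chord_solutionD [OF assms(1) ab C(1,2)])
    fix t assume t: "a \<le> t" "t \<le> b"
    then have "t \<in> I"
      using assms(2) ab unfolding is_interval_1 by blast
    then show "F (x t, l) \<subseteq> C"
      using C(3) [THEN bspec, of t] t assms(3) [OF \<open>t \<in> I\<close>] by simp
  qed
  then show "(y b - y a) /\<^sub>R (b - a) \<in> C"
    using ab assms(3) by simp
qed

lemma chord_solution_subset:
  assumes "chord_solution F l I x" "J \<subseteq> I"
  shows "chord_solution F l J x"
  using assms unfolding chord_solution_def by blast

lemma chord_solution_shift:
  assumes "chord_solution F l I x" "\<And>t. t \<in> J \<Longrightarrow> t + c \<in> I"
  shows "chord_solution F l J (\<lambda>t. x (t + c))"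
  unfolding chord_solution_def
proof (intro ballI allI impI; elim conjE)
  fix a b C
  assume ab: "a \<in> J" "b \<in> J" "a < b" and C: "closed C" "convex C" "\<forall>t\<in>{a..b}. F (x (t + c), l) \<subseteq> C"
  have "(x (b + c) - x (a + c)) /\<^sub>R ((b + c) - (a + c)) \<in> C"
  proof (rule chord_solutionD [OF assms(1) _ _ _ C(1,2)])
    fix t assume "a + c \<le> t" "t \<le> b + c"
    then show "F (x t, l) \<subseteq> C"
      using C(3) [THEN bspec, of "t - c"] by auto
  qed (use ab assms(2) in auto)
  then show "(x (b + c) - x (a + c)) /\<^sub>R (b - a) \<in> C"
    by simp
qed

text \<open>A chord over a junction point is a convex combination of a chord on either side.\<close>
lemma chord_solution_join:
  assumes "chord_solution F l {a..b} x" "chord_solution F l {b..c} x"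
  shows "chord_solution F l {a..c} x"
  unfolding chord_solution_def
proof (intro ballI allI impI; elim conjE)
  fix p q C
  assume pq: "p \<in> {a..c}" "q \<in> {a..c}" "p < q"
    and C: "closed C" "convex C" "\<forall>t\<in>{p..q}. F (x t, l) \<subseteq> C"
  consider "q \<le> b" | "b \<le> p" | "p < b" "b < q"
    by linarith
  then show "(x q - x p) /\<^sub>R (q - p) \<in> C"
  proof cases
    case 1
    then show ?thesis
      using pq C by (intro chord_solutionD [OF assms(1)]) auto
  next
    case 2
    then show ?thesis
      using pq C by (intro chord_solutionD [OF assms(2)]) auto
  next
    case 3
    have "(x b - x p) /\<^sub>R (b - p) \<in> C"
      using pq C 3 by (intro chord_solutionD [OF assms(1)]) auto
    moreover have "(x q - x b) /\<^sub>R (q - b) \<in> C"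
      using pq C 3 by (intro chord_solutionD [OF assms(2)]) auto
    ultimately have "((b - p) / (q - p)) *\<^sub>R ((x b - x p) /\<^sub>R (b - p)) +
        ((q - b) / (q - p)) *\<^sub>R ((x q - x b) /\<^sub>R (q - b)) \<in> C"
      using 3 by (intro convexD [OF C(2)]) (auto simp: diff_divide_distrib [symmetric] add_divide_distrib [symmetric])
    also have "((b - p) / (q - p)) *\<^sub>R ((x b - x p) /\<^sub>R (b - p)) +
        ((q - b) / (q - p)) *\<^sub>R ((x q - x b) /\<^sub>R (q - b)) = (x q - x p) /\<^sub>R (q - p)"
    proof -
      have "(d / e) *\<^sub>R (v /\<^sub>R d) = v /\<^sub>R e" if "d \<noteq> 0" for d e and v :: "real^'n"
        using that by (simp add: divide_inverse)
      then have "((b - p) / (q - p)) *\<^sub>R ((x b - x p) /\<^sub>R (b - p)) +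
          ((q - b) / (q - p)) *\<^sub>R ((x q - x b) /\<^sub>R (q - b)) = (x b - x p) /\<^sub>R (q - p) + (x q - x b) /\<^sub>R (q - p)"
        using 3 by (simp add: inverse_eq_divide)
      also have "\<dots> = (x q - x p) /\<^sub>R (q - p)"
        by (simp flip: scaleR_right_distrib)
      finally show ?thesis .
    qed
    finally show ?thesis .
  qed
qed

text \<open>Projection onto a closed convex set is 1-Lipschitz. Curves on varying intervals thus
  become curves on the whole line with the same constant and the same values, as the compactness
  argument needs.\<close>

lemma lipschitz_closest_point_extension:
  assumes "M-lipschitz_on I x" "closed I" "convex I" "I \<noteq> {}"
  shows "M-lipschitz_on UNIV (x \<circ> closest_point I)"
proof (rule lipschitz_onI)
  fix s t
  have "dist (x (closest_point I s)) (x (closest_point I t)) \<le> M * dist (closest_point I s) (closest_point I t)"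
    using assms by (intro lipschitz_onD [OF assms(1)] closest_point_in_set)
  also have "\<dots> \<le> M * dist s t"
    using assms(2-4) by (intro mult_left_mono closest_point_lipschitz lipschitz_on_nonneg [OF assms(1)])
  finally show "dist ((x \<circ> closest_point I) s) ((x \<circ> closest_point I) t) \<le> M * dist s t"
    by simp
qed (rule lipschitz_on_nonneg [OF assms(1)])

text \<open>Lipschitz curves into a compact set converge along a subsequence at all rational times,
  and the common Lipschitz constant spreads convergence to all times.\<close>
lemma lipschitz_pointwise_convergent_subsequence:
  fixes x :: "nat \<Rightarrow> real \<Rightarrow> 'a::euclidean_space"
  assumes lip: "\<And>k. M-lipschitz_on UNIV (x k)" and X: "compact X" "\<And>k t. x k t \<in> X"
  obtains r y where "strict_mono r" "\<forall>t. (\<lambda>k. x (r k) t) \<longlonglongrightarrow> y t" "\<forall>t. y t \<in> X" "M-lipschitz_on UNIV y"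
proof -
  obtain B where "\<And>z. z \<in> X \<Longrightarrow> norm z \<le> B"
    using compact_imp_bounded [OF X(1)] bounded_iff by blast
  then obtain r where r: "strict_mono r" "\<And>t. t \<in> \<rat> \<Longrightarrow> \<exists>l. (\<lambda>k. x (r k) t) \<longlonglongrightarrow> l"
    using function_convergent_subsequence [OF countable_rat, of x B] X(2) by metis
  have "M \<ge> 0"
    by (rule lipschitz_on_nonneg [OF lip])
  have "convergent (\<lambda>k. x (r k) t)" for t
  proof (rule Cauchy_convergent, rule metric_CauchyI)
    fix e :: real assume "e > 0"
    \<comment> \<open>At this distance each of the two Lipschitz errors is below
      \<open>e / 3\<close>, leaving a third for the convergence at \<open>s\<close>;
      \<open>M + 1\<close> covers \<open>M = 0\<close>.\<close>
    then obtain s where s: "s \<in> \<rat>" "t < s" "s < t + e / (3 * (M + 1))"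
      using Rats_dense_in_real [of t "t + e / (3 * (M + 1))"] \<open>M \<ge> 0\<close> by auto
    have "Cauchy (\<lambda>k. x (r k) s)"
      using r(2) [OF s(1)] LIMSEQ_imp_Cauchy by blast
    then obtain K where K: "\<And>m n. \<lbrakk>m \<ge> K; n \<ge> K\<rbrakk> \<Longrightarrow> dist (x (r m) s) (x (r n) s) < e / 3"
      using \<open>e > 0\<close> metric_CauchyD [of _ "e / 3"] by (metis zero_less_divide_iff zero_less_numeral)
    have near: "dist (x k t) (x k s) < e / 3" for k
    proof -
      have "dist (x k t) (x k s) \<le> M * dist t s"
        using lipschitz_onD [OF lip] by simp
      also have "\<dots> \<le> (M + 1) * (s - t)"
        using s by (simp add: dist_real_def distrib_right)
      also have "\<dots> < e / 3"
        using s \<open>M \<ge> 0\<close> by (simp add: field_simps)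
      finally show ?thesis .
    qed
    have "dist (x (r m) t) (x (r n) t) < e" if "m \<ge> K" "n \<ge> K" for m n
      using near [of "r m"] near [of "r n"] K [OF that]
        dist_triangle [of "x (r m) t" "x (r n) t" "x (r m) s"]
        dist_triangle [of "x (r m) s" "x (r n) t" "x (r n) s"]
      by (simp add: dist_commute)
    then show "\<exists>K. \<forall>m\<ge>K. \<forall>n\<ge>K. dist (x (r m) t) (x (r n) t) < e"
      by blast
  qed
  then obtain y where y: "\<And>t. (\<lambda>k. x (r k) t) \<longlonglongrightarrow> y t"
    unfolding convergent_def by metis
  show thesis
  proof (rule that [OF r(1)])
    show "\<forall>t. (\<lambda>k. x (r k) t) \<longlonglongrightarrow> y t"
      using y by blast
    show "\<forall>t. y t \<in> X"
      using closed_sequentially [OF compact_imp_closed [OF X(1)] _ y] X(2) by blast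
    show "M-lipschitz_on UNIV y"
    proof (rule lipschitz_onI [OF _ \<open>M \<ge> 0\<close>])
      fix s t
      have "(\<lambda>k. dist (x (r k) s) (x (r k) t)) \<longlonglongrightarrow> dist (y s) (y t)"
        by (intro tendsto_dist y)
      then show "dist (y s) (y t) \<le> M * dist s t"
        by (rule LIMSEQ_le_const2) (use lipschitz_onD [OF lip] in auto)
    qed
  qed
qed

text \<open>The domains \<open>J k\<close> need only exhaust the interior of \<open>I\<close>: along a sequence of times
  \<open>T k \<longlonglongrightarrow> T\<close> the intervals \<open>{0..T k}\<close> need not contain \<open>{0..T}\<close>.\<close>
lemma chord_solution_limit:
  assumes fil: "filippov (X \<times> L) F"
    and xs: "\<And>k. chord_solution F (ls k) (J k) (xs k)" "\<And>k. M-lipschitz_on UNIV (xs k)"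
      "\<And>k t. xs k t \<in> X"
    and ls: "\<And>k. ls k \<in> L" "ls \<longlonglongrightarrow> l" "l \<in> L"
    and x: "\<And>t. (\<lambda>k. xs k t) \<longlonglongrightarrow> x t" "\<And>t. x t \<in> X" "M-lipschitz_on UNIV x"
    and I: "is_interval I" "\<And>t. t \<in> interior I \<Longrightarrow> \<exists>\<delta>>0. \<forall>\<^sub>F k in sequentially. {t - \<delta>..t + \<delta>} \<subseteq> J k"
  shows "inclusion_solution F X l I x"
proof (rule inclusion_solution_if_local_chords [OF x(3) I(1) x(2)])
  show "closed (F (x t, l))" for t
    using fil x(2) ls(3) by (auto simp: filippov_def intro: compact_imp_closed)
  fix t \<epsilon> :: real assume t: "t \<in> interior I" and "\<epsilon> > 0"
  let ?C = "closed_nbhd \<epsilon> (F (x t, l))"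
  have C: "closed ?C" "convex ?C"
    using fil x(2) ls(3) by (auto simp: filippov_def intro: closed_closed_nbhd convex_closed_nbhd)
  have xtl: "(x t, l) \<in> X \<times> L"
    using x(2) ls(3) by simp
  obtain \<eta> where \<eta>: "\<eta> > 0" "\<And>y'. \<lbrakk>y' \<in> X \<times> L; dist (x t, l) y' < \<eta>\<rbrakk> \<Longrightarrow> F y' \<subseteq> ?C"
    using fil xtl \<open>\<epsilon> > 0\<close> unfolding filippov_def upper_semicontinuous_on_def by meson
  obtain \<delta> where \<delta>: "\<delta> > 0" "\<forall>\<^sub>F k in sequentially. {t - \<delta>..t + \<delta>} \<subseteq> J k"
    using I(2) [OF t] by blast
  have "M \<ge> 0"
    by (rule lipschitz_on_nonneg [OF x(3)])
  \<comment> \<open>Three errors of at most \<open>\<eta> / 4\<close> each, from the time shift,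
    from the curve at time \<open>t\<close> and from the parameter, stay below
    \<open>\<eta>\<close>. The bound \<open>\<delta>\<close> keeps the times inside the domains
    \<open>J k\<close>.\<close>
  define \<rho> where "\<rho> = min \<delta> (\<eta> / (4 * (M + 1)))"
  have "\<rho> > 0"
    using \<delta> \<eta> \<open>M \<ge> 0\<close> by (simp add: \<rho>_def)
  have "\<rho> \<le> \<eta> / (4 * (M + 1))"
    by (simp add: \<rho>_def)
  then have M\<rho>: "(M + 1) * \<rho> \<le> \<eta> / 4"
    using \<open>M \<ge> 0\<close> by (simp add: field_simps)
  have near: "F (xs k \<tau>, ls k) \<subseteq> ?C"
    if "dist (xs k t) (x t) < \<eta> / 4" "dist (ls k) l < \<eta> / 4" "\<bar>\<tau> - t\<bar> \<le> \<rho>" for k \<tau>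
  proof (rule \<eta>(2))
    show "(xs k \<tau>, ls k) \<in> X \<times> L"
      using xs(3) ls(1) by simp
    have "dist (xs k \<tau>) (xs k t) \<le> M * \<bar>\<tau> - t\<bar>"
      using lipschitz_onD [OF xs(2), of \<tau> t k] by (simp add: dist_real_def)
    also have "\<dots> \<le> (M + 1) * \<rho>"
      using that(3) \<open>M \<ge> 0\<close> by (intro mult_mono) auto
    finally have "dist (x t) (xs k \<tau>) < \<eta> / 2"
      using M\<rho> that(1) dist_triangle3 [of "x t" "xs k \<tau>" "xs k t"] by (simp add: dist_commute)
    moreover have "dist (x t, l) (xs k \<tau>, ls k) \<le> dist (x t) (xs k \<tau>) + dist l (ls k)"
      unfolding dist_Pair_Pair by (rule sqrt_sum_squares_le_sum) auto
    ultimately show "dist (x t, l) (xs k \<tau>, ls k) < \<eta>"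
      using that(2) \<open>\<eta> > 0\<close> by (simp add: dist_commute)
  qed
  \<comment> \<open>The set \<open>?C\<close> and the radius \<open>\<rho>\<close> do not depend on
    \<open>k\<close>, so convergence at the two times \<open>s\<close> and \<open>t\<close> alone
    carries the chord condition to the limit.\<close>
  have "(x s - x t) /\<^sub>R (s - t) \<in> ?C" if s: "s \<noteq> t" "\<bar>s - t\<bar> < \<rho>" for s
  proof (rule Lim_in_closed_set [OF C(1) _ trivial_limit_sequentially])
    show "(\<lambda>k. (xs k s - xs k t) /\<^sub>R (s - t)) \<longlonglongrightarrow> (x s - x t) /\<^sub>R (s - t)"
      by (intro tendsto_intros x)
    have "\<forall>\<^sub>F k in sequentially. dist (xs k t) (x t) < \<eta> / 4" "\<forall>\<^sub>F k in sequentially. dist (ls k) l < \<eta> / 4"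
      using \<open>\<eta> > 0\<close> by (intro tendstoD [OF x(1)] tendstoD [OF ls(2)]; simp)+
    with \<delta>(2) show "\<forall>\<^sub>F k in sequentially. (xs k s - xs k t) /\<^sub>R (s - t) \<in> ?C"
    proof eventually_elim
      case (elim k)
      have st: "s \<in> J k" "t \<in> J k"
        using s \<delta>(1) by (intro subsetD [OF elim(1)]; simp add: \<rho>_def abs_less_iff)+
      show ?case
      proof (cases "t < s")
        case True
        then show ?thesis
          using s by (intro chord_solutionD [OF xs(1) st(2,1) _ C] near [OF elim(2,3)]) auto
      next
        case False
        then have "(xs k t - xs k s) /\<^sub>R (t - s) \<in> ?C"
          using s by (intro chord_solutionD [OF xs(1) st _ C] near [OF elim(2,3)]) auto
        moreover have "(xs k t - xs k s) /\<^sub>R (t - s) = (xs k s - xs k t) /\<^sub>R (s - t)"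
          by (metis inverse_minus_eq minus_diff_eq scaleR_minus_left scaleR_minus_right minus_minus)
        ultimately show ?thesis by simp
      qed
    qed
  qed
  then show "\<forall>\<^sub>F s in at t. (x s - x t) /\<^sub>R (s - t) \<in> ?C"
    using \<open>\<rho> > 0\<close> unfolding eventually_at dist_real_def by blast
qed

section \<open>The multiflow and its isolating neighborhoods\<close>

lemma solution_lipschitz:
  assumes "inclusion_solution F X l I x" "l \<in> L" "M \<ge> 0" "\<And>y. y \<in> X \<times> L \<Longrightarrow> F y \<subseteq> cball 0 M"
  shows "M-lipschitz_on I x"
  using assms inclusion_solution_imp_chord_solution [OF assms(1)]
  by (intro chord_solution_lipschitz) (auto simp: inclusion_solution_def)

text \<open>An instance of the limit lemma with a constant sequence. Values of \<open>x\<close>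
  outside \<open>I\<close> are uncontrolled, while that lemma asks for Lipschitz curves in
  \<open>X\<close> on the whole line; hence the conclusion is about the extension, which agrees with
  \<open>x\<close> on \<open>I\<close>.\<close>

lemma chord_solution_imp_inclusion_solution:
  assumes fil: "filippov (X \<times> L) F" and "compact X" "compact L" "l \<in> L"
    and x: "chord_solution F l I x" "\<And>t. t \<in> I \<Longrightarrow> x t \<in> X"
    and I: "is_interval I" "closed I" "I \<noteq> {}"
  shows "inclusion_solution F X l I (x \<circ> closest_point I)"
proof -
  obtain M where M: "M > 0" "\<And>y. y \<in> X \<times> L \<Longrightarrow> F y \<subseteq> cball 0 M"
    using filippov_bounded [OF compact_Times [OF \<open>compact X\<close> \<open>compact L\<close>] fil] by blast
  have lipI: "M-lipschitz_on I x"
    using M x \<open>l \<in> L\<close> I by (intro chord_solution_lipschitz [OF x(1)]) auto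
  let ?y = "x \<circ> closest_point I"
  have lip: "M-lipschitz_on UNIV ?y"
    using lipI I by (intro lipschitz_closest_point_extension is_interval_convex)
  have X: "?y t \<in> X" for t
    using x(2) closest_point_in_set [OF I(2,3)] by simp
  have chord: "chord_solution F l I ?y"
    by (rule chord_solution_cong [OF x(1) I(1)]) (simp add: closest_point_self)
  show ?thesis
  proof (rule chord_solution_limit [OF fil, of "\<lambda>_. l" "\<lambda>_. I" "\<lambda>_. ?y", OF chord lip X \<open>l \<in> L\<close> _ \<open>l \<in> L\<close> _ X lip I(1)])
    show "\<exists>\<delta>>0. \<forall>\<^sub>F k in sequentially. {t - \<delta>..t + \<delta>} \<subseteq> I" if "t \<in> interior I" for t
      using that unfolding mem_interior_cball cball_eq_atLeastAtMost by auto
  qed auto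
qed

lemma inclusion_flow_iff_chord_solution:
  assumes fil: "filippov (X \<times> L) F" and "compact X" "compact L" "l \<in> L" and "T \<ge> 0"
  shows "b \<in> inclusion_flow F X l T a \<longleftrightarrow>
    (\<exists>x. chord_solution F l {0..T} x \<and> (\<forall>t\<in>{0..T}. x t \<in> X) \<and> x 0 = a \<and> x T = b)"
proof
  assume "b \<in> inclusion_flow F X l T a"
  then show "\<exists>x. chord_solution F l {0..T} x \<and> (\<forall>t\<in>{0..T}. x t \<in> X) \<and> x 0 = a \<and> x T = b"
    using inclusion_solution_imp_chord_solution unfolding inclusion_flow_def inclusion_solution_def by blast
next
  assume "\<exists>x. chord_solution F l {0..T} x \<and> (\<forall>t\<in>{0..T}. x t \<in> X) \<and> x 0 = a \<and> x T = b"
  then obtain x where x: "chord_solution F l {0..T} x" "\<forall>t\<in>{0..T}. x t \<in> X" "x 0 = a" "x T = b"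
    by blast
  have "inclusion_solution F X l {0..T} (x \<circ> closest_point {0..T})"
    using x \<open>T \<ge> 0\<close> by (intro chord_solution_imp_inclusion_solution [OF fil]) (auto intro: assms)
  moreover have "(x \<circ> closest_point {0..T}) 0 = a" "(x \<circ> closest_point {0..T}) T = b"
    using x \<open>T \<ge> 0\<close> by (simp_all add: closest_point_self)
  ultimately show "b \<in> inclusion_flow F X l T a"
    unfolding inclusion_flow_def by blast
qed

text \<open>One sequential statement for two multiflow axioms: constant times and starting points
  give compact values, varying ones give upper semicontinuity.\<close>

lemma inclusion_flow_closed_graph:
  assumes fil: "filippov (X \<times> L) F" and "compact X" "compact L" "l \<in> L"
    and T: "\<And>k. T k \<ge> 0" "T \<longlonglongrightarrow> S" and a: "a \<longlonglongrightarrow> c"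
    and b: "\<And>k. b k \<in> inclusion_flow F X l (T k) (a k)"
  obtains r d where "strict_mono r" "(b \<circ> r) \<longlonglongrightarrow> d" "d \<in> inclusion_flow F X l S c"
proof -
  obtain M where M: "M > 0" "\<And>y. y \<in> X \<times> L \<Longrightarrow> F y \<subseteq> cball 0 M"
    using filippov_bounded [OF compact_Times [OF \<open>compact X\<close> \<open>compact L\<close>] fil] by blast
  have "\<exists>x. inclusion_solution F X l {0..T k} x \<and> x 0 = a k \<and> x (T k) = b k" for k
    using b [of k] by (auto simp: inclusion_flow_def)
  then obtain x where x: "\<And>k. inclusion_solution F X l {0..T k} (x k)" "\<And>k. x k 0 = a k" "\<And>k. x k (T k) = b k"
    by metis
  define y where "y k = x k \<circ> closest_point {0..T k}" for k
  have lip: "M-lipschitz_on UNIV (y k)" for k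
    unfolding y_def using T(1) [of k] M(1)
    by (intro lipschitz_closest_point_extension solution_lipschitz [OF x(1) \<open>l \<in> L\<close> _ M(2)]) auto
  have yx: "y k t = x k t" if "t \<in> {0..T k}" for k t
    using that by (simp add: y_def closest_point_self)
  have X: "y k t \<in> X" for k t
    using x(1) [of k] T(1) [of k] closest_point_in_set [of "{0..T k}" t]
    by (auto simp: inclusion_solution_def y_def simp del: atLeastAtMost_iff)
  have chord: "chord_solution F l {0..T k} (y k)" for k
    by (rule chord_solution_cong [OF inclusion_solution_imp_chord_solution [OF x(1)] _ yx])
      (auto simp: is_interval_cc)
  obtain r z where r: "strict_mono r" and z_all: "\<forall>t. (\<lambda>k. y (r k) t) \<longlonglongrightarrow> z t" "\<forall>t. z t \<in> X"
      and z_lip: "M-lipschitz_on UNIV z"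
    by (rule lipschitz_pointwise_convergent_subsequence [OF lip \<open>compact X\<close> X])
  note z = z_all [rule_format] z_lip
  have Tr: "(\<lambda>k. T (r k)) \<longlonglongrightarrow> S"
    using LIMSEQ_subseq_LIMSEQ [OF T(2) r] by (simp add: o_def)
  have "S \<ge> 0"
    using T by (meson LIMSEQ_le_const)
  have "inclusion_solution F X l {0..S} z"
  proof (rule chord_solution_limit [OF fil, of "\<lambda>_. l" "\<lambda>k. {0..T (r k)}" "\<lambda>k. y (r k)",
        OF chord lip X \<open>l \<in> L\<close> _ \<open>l \<in> L\<close> z is_interval_cc])
    fix t assume "t \<in> interior {0..S}"
    then have t: "0 < t" "t < S"
      by auto
    \<comment> \<open>All domains begin at \<open>0\<close>, so the left margin may be all of
      \<open>t\<close>. The right margin is halved because \<open>T (r k)\<close> may approach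
      \<open>S\<close> from below.\<close>
    define \<delta> where "\<delta> = min t ((S - t) / 2)"
    have "\<delta> > 0" "t + \<delta> < S" "0 \<le> t - \<delta>"
      using t by (auto simp: \<delta>_def min_def field_simps)
    moreover from this have "\<forall>\<^sub>F k in sequentially. t + \<delta> < T (r k)"
      using order_tendstoD(1) [OF Tr] by blast
    then have "\<forall>\<^sub>F k in sequentially. {t - \<delta>..t + \<delta>} \<subseteq> {0..T (r k)}"
      by eventually_elim (use \<open>0 \<le> t - \<delta>\<close> in auto)
    ultimately show "\<exists>\<delta>>0. \<forall>\<^sub>F k in sequentially. {t - \<delta>..t + \<delta>} \<subseteq> {0..T (r k)}"
      by blast
  qed auto
  moreover have "z 0 = c"
  proof (rule LIMSEQ_unique [OF z(1)])
    have "y (r k) 0 = a (r k)" for k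
      using yx [of 0 "r k"] x(2) T(1) by simp
    then show "(\<lambda>k. y (r k) 0) \<longlonglongrightarrow> c"
      using LIMSEQ_subseq_LIMSEQ [OF a r] by (simp add: o_def)
  qed
  ultimately have "z S \<in> inclusion_flow F X l S c"
    unfolding inclusion_flow_def by blast
  moreover have "(b \<circ> r) \<longlonglongrightarrow> z S"
  proof -
    \<comment> \<open>The endpoints are values at moving times; the common Lipschitz constant allows
      comparison with the values at the fixed time \<open>S\<close>.\<close>
    have "(\<lambda>k. M * dist (T (r k)) S) \<longlonglongrightarrow> M * dist S S"
      by (intro tendsto_intros Tr)
    then have "(\<lambda>k. M * dist (T (r k)) S) \<longlonglongrightarrow> 0"
      by simp
    then have "(\<lambda>k. y (r k) (T (r k)) - y (r k) S) \<longlonglongrightarrow> 0"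
      by (rule Lim_null_comparison [rotated])
        (use lipschitz_onD [OF lip] in \<open>auto simp: dist_norm\<close>)
    from tendsto_add [OF this z(1) [of S]] have "(\<lambda>k. y (r k) (T (r k))) \<longlonglongrightarrow> z S"
      by simp
    moreover have "y (r k) (T (r k)) = b (r k)" for k
      using yx [of "T (r k)" "r k"] x(3) T(1) by simp
    ultimately show ?thesis
      by (simp add: o_def)
  qed
  ultimately show thesis
    using that r by blast
qed

section \<open>Multiflow axioms\<close>

lemma inclusion_flow_subset: "T \<ge> 0 \<Longrightarrow> inclusion_flow F X l T a \<subseteq> X"
  unfolding inclusion_flow_def inclusion_solution_def by auto

lemma inclusion_flow_zero:
  assumes "a \<in> X"
  shows "inclusion_flow F X l 0 a = {a}"
proof -
  have "inclusion_solution F X l {0..0} (\<lambda>_. a)"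
    unfolding inclusion_solution_def
  proof (intro conjI allI impI ballI assms is_interval_cc)
    show "abs_continuous_between p q (\<lambda>_. a)" for p q
      by (intro lipschitz_abs_continuous_between [of 0] lipschitz_on_constant)
    \<comment> \<open>The time interval is a single point, hence null, so the differential condition
      is vacuous almost everywhere.\<close>
    have "AE t::real in lebesgue. t \<notin> {0}"
      by (intro AE_not_in) (simp flip: negligible_iff_null_sets)
    then show "AE t in lebesgue. t \<in> {0..0} \<longrightarrow>
        (\<exists>v\<in>F (a, l). ((\<lambda>_. a) has_vector_derivative v) (at t within {0..0}))"
      by (rule AE_mp) auto
  qed
  then show ?thesis
    unfolding inclusion_flow_def by auto
qed

lemma inclusion_flow_add:
  assumes fil: "filippov (X \<times> L) F" and "compact X" "compact L" "l \<in> L" and "t \<ge> 0" "s \<ge> 0"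
  shows "(\<Union>y\<in>inclusion_flow F X l s a. inclusion_flow F X l t y) = inclusion_flow F X l (t + s) a"
proof (intro equalityI subsetI)
  note flow_iff = inclusion_flow_iff_chord_solution [OF fil \<open>compact X\<close> \<open>compact L\<close> \<open>l \<in> L\<close>]
  fix b
  {
    assume "b \<in> (\<Union>y\<in>inclusion_flow F X l s a. inclusion_flow F X l t y)"
    then obtain x1 x2 where x1: "chord_solution F l {0..s} x1" "\<forall>\<tau>\<in>{0..s}. x1 \<tau> \<in> X" "x1 0 = a"
      and x2: "chord_solution F l {0..t} x2" "\<forall>\<tau>\<in>{0..t}. x2 \<tau> \<in> X" "x2 0 = x1 s" "x2 t = b"
      using flow_iff \<open>t \<ge> 0\<close> \<open>s \<ge> 0\<close> by auto
    \<comment> \<open>Adding \<open>- s\<close> fits the translation lemma. Both branches agree at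
      the junction since \<open>x2 0 = x1 s\<close>, so \<open>x\<close> restricts to a chord
      solution on either closed half.\<close>
    define x where "x \<tau> = (if \<tau> \<le> s then x1 \<tau> else x2 (\<tau> + (- s)))" for \<tau>
    have "chord_solution F l {0..s} x"
      by (rule chord_solution_cong [OF x1(1)]) (auto simp: x_def is_interval_cc)
    moreover have "chord_solution F l {s..t + s} (\<lambda>\<tau>. x2 (\<tau> + (- s)))"
      by (rule chord_solution_shift [OF x2(1)]) auto
    then have "chord_solution F l {s..t + s} x"
      by (rule chord_solution_cong) (use x2(3) in \<open>auto simp: x_def is_interval_cc\<close>)
    ultimately have "chord_solution F l {0..t + s} x"
      by (rule chord_solution_join)
    moreover have "\<forall>\<tau>\<in>{0..t + s}. x \<tau> \<in> X"
      using x1(2) x2(2) by (auto simp: x_def)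
    moreover have "x 0 = a"
      using x1(3) \<open>s \<ge> 0\<close> by (simp add: x_def)
    moreover have "x (t + s) = b"
      using x2(3,4) \<open>t \<ge> 0\<close> by (cases "t = 0") (auto simp: x_def)
    ultimately show "b \<in> inclusion_flow F X l (t + s) a"
      using flow_iff [of "t + s"] \<open>t \<ge> 0\<close> \<open>s \<ge> 0\<close> by auto
  next
    assume "b \<in> inclusion_flow F X l (t + s) a"
    then obtain x where x: "chord_solution F l {0..t + s} x" "\<forall>\<tau>\<in>{0..t + s}. x \<tau> \<in> X" "x 0 = a" "x (t + s) = b"
      using flow_iff [of "t + s"] \<open>t \<ge> 0\<close> \<open>s \<ge> 0\<close> by auto
    have "chord_solution F l {0..s} x"
      using x(1) by (rule chord_solution_subset) (use \<open>t \<ge> 0\<close> in auto)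
    then have "x s \<in> inclusion_flow F X l s a"
      using flow_iff [of s] x \<open>t \<ge> 0\<close> \<open>s \<ge> 0\<close> by auto
    moreover have "chord_solution F l {0..t} (\<lambda>\<tau>. x (\<tau> + s))"
      by (rule chord_solution_shift [OF x(1)]) (use \<open>s \<ge> 0\<close> in auto)
    then have "b \<in> inclusion_flow F X l t (x s)"
      using flow_iff [of t] x \<open>t \<ge> 0\<close> \<open>s \<ge> 0\<close> by (auto intro!: exI [of _ "\<lambda>\<tau>. x (\<tau> + s)"])
    ultimately show "b \<in> (\<Union>y\<in>inclusion_flow F X l s a. inclusion_flow F X l t y)"
      by blast
  }
qed

lemma multiflow_inclusion_flow:
  fixes X :: "(real^'n) set"
  assumes fil: "filippov (X \<times> L) F" and "compact X" "compact L" "l \<in> L"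
  shows "multiflow X (inclusion_flow F X l)"
  unfolding multiflow_def
proof (intro conjI allI impI ballI)
  note closed_graph = inclusion_flow_closed_graph [OF assms]
  show sub: "inclusion_flow F X l t x \<subseteq> X" if "t \<ge> 0" for t x
    using that by (rule inclusion_flow_subset)
  show "compact (inclusion_flow F X l t x)" if t: "t \<ge> 0" for t x
    unfolding compact_def
  proof (intro allI impI)
    fix b :: "nat \<Rightarrow> _" assume b: "\<forall>k. b k \<in> inclusion_flow F X l t x"
    obtain r d where "strict_mono r" "(b \<circ> r) \<longlonglongrightarrow> d" "d \<in> inclusion_flow F X l t x"
      by (rule closed_graph [of "\<lambda>_. t" t "\<lambda>_. x" x b]) (use t b in auto)
    then show "\<exists>d\<in>inclusion_flow F X l t x. \<exists>r. strict_mono r \<and> (b \<circ> r) \<longlonglongrightarrow> d"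
      by blast
  qed
  show "inclusion_flow F X l 0 x = {x}" if "x \<in> X" for x
    by (rule inclusion_flow_zero [OF that])
  show "(\<Union>y\<in>inclusion_flow F X l s x. inclusion_flow F X l t y) = inclusion_flow F X l (t + s) x"
    if "t \<ge> 0" "s \<ge> 0" for t s x
    by (rule inclusion_flow_add [OF assms that])
  show "upper_semicontinuous_on ({0..} \<times> X) (\<lambda>(t, x). inclusion_flow F X l t x)"
    unfolding upper_semicontinuous_on_def
  proof (intro ballI allI impI, rule ccontr)
    fix y :: "real \<times> (real^'n)" and \<epsilon> :: real
    assume y: "y \<in> {0..} \<times> X" and "\<epsilon> > 0"
    obtain t x where tx: "y = (t, x)" "t \<ge> 0" "x \<in> X"
      using y by auto
    let ?\<Phi> = "\<lambda>(t, x). inclusion_flow F X l t x"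
    assume neg: "\<not> (\<exists>\<delta>>0. \<forall>y'\<in>{0..} \<times> X. dist y y' < \<delta> \<longrightarrow> ?\<Phi> y' \<subseteq> closed_nbhd \<epsilon> (?\<Phi> y))"
    have "\<exists>y' b. y' \<in> {0..} \<times> X \<and> dist y y' < 1 / real (Suc k) \<and> b \<in> ?\<Phi> y' \<and> b \<notin> closed_nbhd \<epsilon> (?\<Phi> y)" for k
    proof -
      have "1 / real (Suc k) > 0" by simp
      then show ?thesis
        using neg by blast
    qed
    then obtain z b where z: "\<And>k. z k \<in> {0..} \<times> X" "\<And>k. dist y (z k) < 1 / real (Suc k)"
      and b: "\<And>k. b k \<in> ?\<Phi> (z k)" "\<And>k. b k \<notin> closed_nbhd \<epsilon> (?\<Phi> y)"
      by metis
    have "z \<longlonglongrightarrow> y"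
    proof (rule metric_tendsto_imp_tendsto [OF LIMSEQ_inverse_real_of_nat])
      show "\<forall>\<^sub>F k in sequentially. dist (z k) y \<le> dist (inverse (real (Suc k))) 0"
        using z(2) by (intro always_eventually allI) (simp add: dist_commute less_imp_le inverse_eq_divide)
    qed
    then have lims: "(\<lambda>k. fst (z k)) \<longlonglongrightarrow> t" "(\<lambda>k. snd (z k)) \<longlonglongrightarrow> x"
      using tendsto_fst tendsto_snd tx(1) by fastforce+
    have bz: "b k \<in> inclusion_flow F X l (fst (z k)) (snd (z k))" "0 \<le> fst (z k)" for k
      using b(1) [of k] z(1) [of k] by (auto simp: case_prod_beta mem_Times_iff)
    obtain r d where "strict_mono r" and br: "(b \<circ> r) \<longlonglongrightarrow> d" and "d \<in> inclusion_flow F X l t x"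
      by (rule closed_graph [OF bz(2) lims bz(1)])
    then have d: "d \<in> ?\<Phi> y"
      by (simp add: tx(1))
    have "\<forall>\<^sub>F k in sequentially. dist ((b \<circ> r) k) d < \<epsilon>"
      using br \<open>\<epsilon> > 0\<close> by (rule tendstoD)
    then obtain k where "dist (b (r k)) d < \<epsilon>"
      by (auto dest: eventually_happens)
    \<comment> \<open>The limit \<open>d\<close> also witnesses that the value at \<open>y\<close>
      is non-empty, which \<open>closed_nbhd\<close> demands and which is not automatic for the
      flow.\<close>
    then have "b (r k) \<in> closed_nbhd \<epsilon> (?\<Phi> y)"
      using d infdist_le [OF d, of "b (r k)"] unfolding closed_nbhd_def by auto
    then show False
      using b(2) by blast
  qed
qed

text \<open>Upper semicontinuity of the maximal invariant set in the parameter, in sequential form.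
  Orbits here live on the whole line already, so no extension of curves is needed, and closedness of
  \<open>N\<close> keeps the limit orbit inside.\<close>

lemma maximal_invariant_set_closed_graph:
  assumes fil: "filippov (X \<times> L) F" and "compact X" "compact L"
    and N: "closed N" "N \<subseteq> X" and ls: "\<And>k. ls k \<in> L" "ls \<longlonglongrightarrow> l"
    and p: "\<And>k. p k \<in> maximal_invariant_set F X (ls k) N"
  obtains r q where "strict_mono r" "(p \<circ> r) \<longlonglongrightarrow> q" "q \<in> maximal_invariant_set F X l N"
proof -
  obtain M where M: "M > 0" "\<And>y. y \<in> X \<times> L \<Longrightarrow> F y \<subseteq> cball 0 M"
    using filippov_bounded [OF compact_Times [OF \<open>compact X\<close> \<open>compact L\<close>] fil] by blast
  have "\<exists>x. inclusion_solution F X (ls k) UNIV x \<and> (\<forall>t. x t \<in> N) \<and> x 0 = p k" for k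
    using p [of k] unfolding maximal_invariant_set_def by blast
  then obtain x where x: "\<And>k. inclusion_solution F X (ls k) UNIV (x k)" "\<And>k t. x k t \<in> N" "\<And>k. x k 0 = p k"
    by metis
  have lip: "M-lipschitz_on UNIV (x k)" for k
    using M by (intro solution_lipschitz [OF x(1) ls(1)]) auto
  have X: "x k t \<in> X" for k t
    using x(2) N by blast
  obtain r z where r: "strict_mono r" and z_all: "\<forall>t. (\<lambda>k. x (r k) t) \<longlonglongrightarrow> z t" "\<forall>t. z t \<in> X"
      and z_lip: "M-lipschitz_on UNIV z"
    by (rule lipschitz_pointwise_convergent_subsequence [OF lip \<open>compact X\<close> X])
  note z = z_all [rule_format] z_lip
  have lr: "(\<lambda>k. ls (r k)) \<longlonglongrightarrow> l"
    using LIMSEQ_subseq_LIMSEQ [OF ls(2) r] by (simp add: o_def)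
  have "l \<in> L"
    using closed_sequentially [OF compact_imp_closed [OF \<open>compact L\<close>] _ ls(2)] ls(1) by blast
  have "inclusion_solution F X l UNIV z"
    by (rule chord_solution_limit [OF fil, of "\<lambda>k. ls (r k)" "\<lambda>_. UNIV" "\<lambda>k. x (r k)",
        OF inclusion_solution_imp_chord_solution [OF x(1)] lip X ls(1) lr \<open>l \<in> L\<close> z])
      (auto intro: zero_less_one)
  moreover have zN: "z t \<in> N" for t
    using closed_sequentially [OF N(1) _ z(1)] x(2) by blast
  ultimately have "z 0 \<in> maximal_invariant_set F X l N"
    unfolding maximal_invariant_set_def by blast
  moreover have "(p \<circ> r) \<longlonglongrightarrow> z 0"
    using z(1) [of 0] x(3) by (simp add: o_def)
  ultimately show thesis
    using that r by blast
qed

theorem theorem5p1: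
  fixes X N :: "(real^'n) set"
    and F :: "(real^'n) \<times> real \<Rightarrow> (real^'n) set"
  assumes "compact X"
    and "filippov (X \<times> {-1..1}) F"
  shows "(\<forall>l\<in>{-1..1}. multiflow X (inclusion_flow F X l)) \<and>
         (isolating_neighborhood F X 0 N \<longrightarrow>
           (\<exists>\<epsilon>>0. \<forall>l\<in>{-1..1}. \<bar>l\<bar> < \<epsilon> \<longrightarrow> isolating_neighborhood F X l N))"
proof (intro conjI ballI impI)
  show "multiflow X (inclusion_flow F X l)" if "l \<in> {-1..1}" for l
    using assms that by (intro multiflow_inclusion_flow [of X "{-1..1}"]) auto
next
  assume iso: "isolating_neighborhood F X 0 N"
  then have N: "closed N" "N \<subseteq> X" "compact N"
    by (auto simp: isolating_neighborhood_def compact_imp_closed)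
  show "\<exists>\<epsilon>>0. \<forall>l\<in>{-1..1}. \<bar>l\<bar> < \<epsilon> \<longrightarrow> isolating_neighborhood F X l N"
  proof (rule ccontr)
    assume neg: "\<not> ?thesis"
    \<comment> \<open>Compactness of \<open>N\<close> and \<open>N \<subseteq> X\<close> do not
      involve the parameter, so failure at \<open>l\<close> can only mean an invariant point on the
      frontier.\<close>
    have "\<exists>l q. l \<in> {-1..1} \<and> \<bar>l\<bar> < 1 / real (Suc k) \<and> q \<in> maximal_invariant_set F X l N \<and> q \<in> frontier N" for k
    proof -
      have "1 / real (Suc k) > 0" by simp
      then show ?thesis
        using neg N unfolding isolating_neighborhood_def by blast
    qed
    then obtain ls p where ls: "\<And>k. ls k \<in> {-1..1}" "\<And>k. \<bar>ls k\<bar> < 1 / real (Suc k)"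
      and p: "\<And>k. p k \<in> maximal_invariant_set F X (ls k) N" "\<And>k. p k \<in> frontier N"
      by metis
    have "ls \<longlonglongrightarrow> 0"
      by (rule Lim_null_comparison [OF _ LIMSEQ_inverse_real_of_nat])
        (use ls(2) in \<open>simp add: less_imp_le inverse_eq_divide\<close>)
    obtain r q where "strict_mono r" and q: "(p \<circ> r) \<longlonglongrightarrow> q" "q \<in> maximal_invariant_set F X 0 N"
      by (rule maximal_invariant_set_closed_graph [OF assms(2,1) compact_Icc N(1,2) ls(1) \<open>ls \<longlonglongrightarrow> 0\<close> p(1)])
    moreover have "q \<in> frontier N"
      using closed_sequentially [OF frontier_closed _ q(1)] p(2) by simp
    ultimately show False
      using iso by (auto simp: isolating_neighborhood_def)
  qed
qed

end
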